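(* Let $k$ be a commutative ring, $G$ a group, and $\mathcal{C}$ a free $G$-category over $k$. Then the quotient category $\mathcal{C}/G$ and the skew category $\mathcal{C}[G]$ are equivalent (as categories over $k$).
   Context: Category over $k$: a small category $\mathcal{C}$ with object set $\mathcal{C}_0$ such that each morphism set ${}_y\mathcal{C}_x$ (morphisms from $x$ to $y$) is a $k$-module and composition is $k$-bilinear. Functors, equivalences and isomorphisms between categories over $k$ are understood to be $k$-linear. $G$-category over $k$: a category $\mathcal{C}$ over $k$ with an action of $G$ on the set $\mathcal{C}_0$ and $k$-module maps $s:{}_y\mathcal{C}_x\to{}_{sy}\mathcal{C}_{sx}$ for all $s\in G$ and objects $x,y$, such that $s(gf)=(sg)(sf)$ for composable $g,f$, $(ts)f=t(sf)$ and $1f=f$ (i.e. a group homomorphism from $G$ to the group of autofunctors of $\mathcal{C}$). It is free if the action on $\mathcal{C}_0$ is free ($sx=x$ for some object $x$ implies $s=1$). Quotient category $\mathcal{C}/G$ (for $\mathcal{C}$ a free $G$-category): objects are the $G$-orbits of $\mathcal{C}_0$, and ${}_\beta(\mathcal{C}/G)_\alpha=\left(\bigoplus_{x\in\alpha,\,y\in\beta}{}_y\mathcal{C}_x\right)/G$, where for a $kG$-module $X$ one sets $X/G=X/(\ker\epsilon)X$ with $\epsilon:kG\to k$ the augmentation map (the module of coinvariants). Composition is induced from $\mathcal{C}$: if $f\in{}_y\mathcal{C}_x$, $g\in{}_z\mathcal{C}_{y'}$ with $y,y'$ in the same orbit and $s$ is the unique element of $G$ with $sy=y'$, then $[g][f]=[g\circ(sf)]$.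 Skew category $\mathcal{C}[G]$ (for $\mathcal{C}$ a $G$-category): objects $\mathcal{C}_0$, morphisms ${}_y(\mathcal{C}[G])_x=\bigoplus_{s\in G}{}_y\mathcal{C}_{sx}$ (external direct sum indexed by $s$). For $g$ in the component ${}_z\mathcal{C}_{ty}$ indexed by $t$ and $f$ in the component ${}_y\mathcal{C}_{sx}$ indexed by $s$, the composite is $gf=g\circ(tf)$, in the component ${}_z\mathcal{C}_{tsx}$ indexed by $ts$. *)

theory Defs
  imports "HOL-Algebra.Algebra"
begin

section \<open>Linear maps, direct sums and quotients of modules\<close>

definition mod_hom ::
  "('k, 'r) ring_scheme \<Rightarrow> ('k, 'm, 'c) module_scheme \<Rightarrow> ('k, 'n, 'd) module_scheme \<Rightarrow> ('m \<Rightarrow> 'n) set"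
  where "mod_hom K M N =
    {f \<in> carrier M \<rightarrow> carrier N.
      (\<forall>u\<in>carrier M. \<forall>v\<in>carrier M. f (u \<oplus>\<^bsub>M\<^esub> v) = f u \<oplus>\<^bsub>N\<^esub> f v) \<and>
      (\<forall>a\<in>carrier K. \<forall>u\<in>carrier M. f (a \<odot>\<^bsub>M\<^esub> u) = a \<odot>\<^bsub>N\<^esub> f u)}"

text \<open>The locale \<^locale>\<open>module\<close> uses only the additive and scalar structure of its record;
  the fields \<^const>\<open>monoid.mult\<close> and \<^const>\<open>one\<close> are left unspecified below.\<close>

definition direct_sum :: "'i set \<Rightarrow> ('i \<Rightarrow> ('k, 'm, 'c) module_scheme) \<Rightarrow> ('k, 'i \<Rightarrow> 'm) module"
  where "direct_sum I M =
    \<lparr>carrier = {f \<in> (\<Pi>\<^sub>E i\<in>I. carrier (M i)). finite {i \<in> I. f i \<noteq> \<zero>\<^bsub>M i\<^esub>}},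
     monoid.mult = undefined, one = undefined,
     ring.zero = (\<lambda>i\<in>I. \<zero>\<^bsub>M i\<^esub>),
     add = (\<lambda>f g. \<lambda>i\<in>I. f i \<oplus>\<^bsub>M i\<^esub> g i),
     smult = (\<lambda>a f. \<lambda>i\<in>I. a \<odot>\<^bsub>M i\<^esub> f i)\<rparr>"

definition supp :: "'i set \<Rightarrow> ('i \<Rightarrow> ('k, 'm, 'c) module_scheme) \<Rightarrow> ('i \<Rightarrow> 'm) \<Rightarrow> 'i set"
  where "supp I M f = {i \<in> I. f i \<noteq> \<zero>\<^bsub>M i\<^esub>}"

definition single :: "'i set \<Rightarrow> ('i \<Rightarrow> ('k, 'm, 'c) module_scheme) \<Rightarrow> 'i \<Rightarrow> 'm \<Rightarrow> 'i \<Rightarrow> 'm"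
  where "single I M i u = (\<lambda>j\<in>I. if j = i then u else \<zero>\<^bsub>M j\<^esub>)"

definition quot_module :: "('k, 'm, 'c) module_scheme \<Rightarrow> 'm set \<Rightarrow> ('k, 'm set) module"
  where "quot_module M N =
    \<lparr>carrier = a_rcosets\<^bsub>M\<^esub> N,
     monoid.mult = undefined, one = undefined,
     ring.zero = N,
     add = (\<lambda>P Q. P <+>\<^bsub>M\<^esub> Q),
     smult = (\<lambda>a P. \<Union>u\<in>P. N +>\<^bsub>M\<^esub> (a \<odot>\<^bsub>M\<^esub> u))\<rparr>"


section \<open>Coinvariants\<close>

text \<open>The elements of the group algebra \<open>kG\<close>, as finitely supported coefficient functions.\<close>

definition group_algebra :: "('k, 'r) ring_scheme \<Rightarrow> ('g, 'h) monoid_scheme \<Rightarrow> ('g \<Rightarrow> 'k) set"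
  where "group_algebra K G =
    {a \<in> carrier G \<rightarrow>\<^sub>E carrier K. finite {s \<in> carrier G. a s \<noteq> \<zero>\<^bsub>K\<^esub>}}"

definition augmentation ::
  "('k, 'r) ring_scheme \<Rightarrow> ('g, 'h) monoid_scheme \<Rightarrow> ('g \<Rightarrow> 'k) \<Rightarrow> 'k"
  where "augmentation K G a = (\<Oplus>\<^bsub>K\<^esub>s\<in>{s \<in> carrier G. a s \<noteq> \<zero>\<^bsub>K\<^esub>}. a s)"

text \<open>A \<open>kG\<close>-module is given by a \<open>k\<close>-module \<open>M\<close> and the operators \<open>\<sigma> s\<close> by which
  the elements \<open>s\<close> of \<open>G\<close> act on it.\<close>

definition ga_smult ::
  "('k, 'r) ring_scheme \<Rightarrow> ('g, 'h) monoid_scheme \<Rightarrow> ('k, 'm, 'c) module_scheme \<Rightarrow>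
    ('g \<Rightarrow> 'm \<Rightarrow> 'm) \<Rightarrow> ('g \<Rightarrow> 'k) \<Rightarrow> 'm \<Rightarrow> 'm"
  where "ga_smult K G M \<sigma> a u =
    (\<Oplus>\<^bsub>M\<^esub>s\<in>{s \<in> carrier G. a s \<noteq> \<zero>\<^bsub>K\<^esub>}. a s \<odot>\<^bsub>M\<^esub> \<sigma> s u)"

definition aug_submodule ::
  "('k, 'r) ring_scheme \<Rightarrow> ('g, 'h) monoid_scheme \<Rightarrow> ('k, 'm, 'c) module_scheme \<Rightarrow>
    ('g \<Rightarrow> 'm \<Rightarrow> 'm) \<Rightarrow> 'm set"
  where "aug_submodule K G M \<sigma> =
    generate (add_monoid M)
      {ga_smult K G M \<sigma> a u | a u.
        a \<in> group_algebra K G \<and> augmentation K G a = \<zero>\<^bsub>K\<^esub> \<and> u \<in> carrier M}"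

definition coinvariants ::
  "('k, 'r) ring_scheme \<Rightarrow> ('g, 'h) monoid_scheme \<Rightarrow> ('k, 'm, 'c) module_scheme \<Rightarrow>
    ('g \<Rightarrow> 'm \<Rightarrow> 'm) \<Rightarrow> ('k, 'm set) module"
  where "coinvariants K G M \<sigma> = quot_module M (aug_submodule K G M \<sigma>)"


section \<open>Categories over a commutative ring\<close>

text \<open>\<open>Hom C y x\<close> is the module of morphisms from \<open>x\<close> to \<open>y\<close>, and \<open>Comp C z y x g f\<close> is the
  composite of \<open>f\<close> from \<open>x\<close> to \<open>y\<close> with \<open>g\<close> from \<open>y\<close> to \<open>z\<close>.  Different morphism modules may
  overlap as sets, so operations on morphisms take the objects as arguments.\<close>

record ('k, 'o, 'm) lincat =
  Obj :: "'o set"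
  Hom :: "'o \<Rightarrow> 'o \<Rightarrow> ('k, 'm) module"
  Comp :: "'o \<Rightarrow> 'o \<Rightarrow> 'o \<Rightarrow> 'm \<Rightarrow> 'm \<Rightarrow> 'm"
  Id :: "'o \<Rightarrow> 'm"

locale category_over = K: cring K
  for K :: "('k, 'r) ring_scheme" (structure) and C :: "('k, 'o, 'm) lincat" +
  assumes Hom_module: "\<lbrakk>x \<in> Obj C; y \<in> Obj C\<rbrakk> \<Longrightarrow> module K (Hom C y x)"
    and Comp_linear_left:
      "\<lbrakk>x \<in> Obj C; y \<in> Obj C; z \<in> Obj C; f \<in> carrier (Hom C y x)\<rbrakk> \<Longrightarrow>
        (\<lambda>g. Comp C z y x g f) \<in> mod_hom K (Hom C z y) (Hom C z x)"
    and Comp_linear_right: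
      "\<lbrakk>x \<in> Obj C; y \<in> Obj C; z \<in> Obj C; g \<in> carrier (Hom C z y)\<rbrakk> \<Longrightarrow>
        (\<lambda>f. Comp C z y x g f) \<in> mod_hom K (Hom C y x) (Hom C z x)"
    and Comp_assoc:
      "\<lbrakk>x \<in> Obj C; y \<in> Obj C; z \<in> Obj C; w \<in> Obj C;
        f \<in> carrier (Hom C y x); g \<in> carrier (Hom C z y); h \<in> carrier (Hom C w z)\<rbrakk> \<Longrightarrow>
        Comp C w y x (Comp C w z y h g) f = Comp C w z x h (Comp C z y x g f)"
    and Id_closed: "x \<in> Obj C \<Longrightarrow> Id C x \<in> carrier (Hom C x x)"
    and Id_left:
      "\<lbrakk>x \<in> Obj C; y \<in> Obj C; f \<in> carrier (Hom C y x)\<rbrakk> \<Longrightarrow> Comp C y y x (Id C y) f = f"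
    and Id_right:
      "\<lbrakk>x \<in> Obj C; y \<in> Obj C; f \<in> carrier (Hom C y x)\<rbrakk> \<Longrightarrow> Comp C y x x f (Id C x) = f"

locale linear_functor = C: category_over K C + D: category_over K D
  for K :: "('k, 'r) ring_scheme" (structure)
    and C :: "('k, 'o, 'm) lincat" and D :: "('k, 'p, 'n) lincat" +
  fixes Fo :: "'o \<Rightarrow> 'p" and Fm :: "'o \<Rightarrow> 'o \<Rightarrow> 'm \<Rightarrow> 'n"
  assumes F_Obj: "x \<in> Obj C \<Longrightarrow> Fo x \<in> Obj D"
    and F_linear:
      "\<lbrakk>x \<in> Obj C; y \<in> Obj C\<rbrakk> \<Longrightarrow> Fm y x \<in> mod_hom K (Hom C y x) (Hom D (Fo y) (Fo x))"
    and F_Comp: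
      "\<lbrakk>x \<in> Obj C; y \<in> Obj C; z \<in> Obj C; f \<in> carrier (Hom C y x); g \<in> carrier (Hom C z y)\<rbrakk> \<Longrightarrow>
        Fm z x (Comp C z y x g f) = Comp D (Fo z) (Fo y) (Fo x) (Fm z y g) (Fm y x f)"
    and F_Id: "x \<in> Obj C \<Longrightarrow> Fm x x (Id C x) = Id D (Fo x)"

locale natural_isomorphism =
  F: linear_functor K C D Fo Fm + H: linear_functor K C D Ho Hm
  for K :: "('k, 'r) ring_scheme" (structure)
    and C :: "('k, 'o, 'm) lincat" and D :: "('k, 'p, 'n) lincat"
    and Fo Fm Ho Hm +
  fixes \<eta> :: "'o \<Rightarrow> 'n"
  assumes component: "x \<in> Obj C \<Longrightarrow> \<eta> x \<in> carrier (Hom D (Ho x) (Fo x))"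
    and natural:
      "\<lbrakk>x \<in> Obj C; y \<in> Obj C; f \<in> carrier (Hom C y x)\<rbrakk> \<Longrightarrow>
        Comp D (Ho y) (Fo y) (Fo x) (\<eta> y) (Fm y x f) =
        Comp D (Ho y) (Ho x) (Fo x) (Hm y x f) (\<eta> x)"
    and invertible:
      "x \<in> Obj C \<Longrightarrow> \<exists>\<theta> \<in> carrier (Hom D (Fo x) (Ho x)).
        Comp D (Fo x) (Ho x) (Fo x) \<theta> (\<eta> x) = Id D (Fo x) \<and>
        Comp D (Ho x) (Fo x) (Ho x) (\<eta> x) \<theta> = Id D (Ho x)"

definition equivalent_over ::
  "('k, 'r) ring_scheme \<Rightarrow> ('k, 'o, 'm) lincat \<Rightarrow> ('k, 'p, 'n) lincat \<Rightarrow> bool"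
  where "equivalent_over K C D \<longleftrightarrow>
    (\<exists>Fo Fm Ho Hm \<eta> \<theta>.
      linear_functor K C D Fo Fm \<and>
      linear_functor K D C Ho Hm \<and>
      natural_isomorphism K C C
        (\<lambda>x. x) (\<lambda>y x f. f) (\<lambda>x. Ho (Fo x)) (\<lambda>y x f. Hm (Fo y) (Fo x) (Fm y x f)) \<eta> \<and>
      natural_isomorphism K D D
        (\<lambda>x. Fo (Ho x)) (\<lambda>y x f. Fm (Ho y) (Ho x) (Hm y x f)) (\<lambda>x. x) (\<lambda>y x f. f) \<theta>)"


section \<open>Categories with a group action\<close>

text \<open>\<open>act s\<close> is the action of \<open>s\<close> on objects and \<open>actM s y x\<close> its action on morphisms from \<open>x\<close>
  to \<open>y\<close>.  That \<open>s\<close> preserves identities follows from \<open>actM_Comp\<close> and the invertibility of \<open>s\<close>.\<close>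

locale G_category = category_over K C + group G + group_action G "Obj C" act
  for K :: "('k, 'r) ring_scheme" (structure) and G :: "('g, 'h) monoid_scheme" (structure)
    and C :: "('k, 'o, 'm) lincat" and act :: "'g \<Rightarrow> 'o \<Rightarrow> 'o" +
  fixes actM :: "'g \<Rightarrow> 'o \<Rightarrow> 'o \<Rightarrow> 'm \<Rightarrow> 'm"
  assumes actM_linear:
      "\<lbrakk>s \<in> carrier G; x \<in> Obj C; y \<in> Obj C\<rbrakk> \<Longrightarrow>
        actM s y x \<in> mod_hom K (Hom C y x) (Hom C (act s y) (act s x))"
    and actM_Comp:
      "\<lbrakk>s \<in> carrier G; x \<in> Obj C; y \<in> Obj C; z \<in> Obj C;
        f \<in> carrier (Hom C y x); g \<in> carrier (Hom C z y)\<rbrakk> \<Longrightarrow>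
        actM s z x (Comp C z y x g f) =
        Comp C (act s z) (act s y) (act s x) (actM s z y g) (actM s y x f)"
    and actM_mult:
      "\<lbrakk>s \<in> carrier G; t \<in> carrier G; x \<in> Obj C; y \<in> Obj C; f \<in> carrier (Hom C y x)\<rbrakk> \<Longrightarrow>
        actM (t \<otimes>\<^bsub>G\<^esub> s) y x f = actM t (act s y) (act s x) (actM s y x f)"
    and actM_one:
      "\<lbrakk>x \<in> Obj C; y \<in> Obj C; f \<in> carrier (Hom C y x)\<rbrakk> \<Longrightarrow> actM \<one>\<^bsub>G\<^esub> y x f = f"

locale free_G_category = G_category +
  assumes free: "\<lbrakk>s \<in> carrier G; x \<in> Obj C; act s x = x\<rbrakk> \<Longrightarrow> s = \<one>\<^bsub>G\<^esub>"


section \<open>The quotient category\<close>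

text \<open>The direct sum of all \<open>Hom C y x\<close> with \<open>y \<in> \<beta>\<close> and \<open>x \<in> \<alpha>\<close>, indexed by the pairs \<open>(y, x)\<close>.\<close>

definition orbit_homs :: "('k, 'o, 'm) lincat \<Rightarrow> 'o set \<Rightarrow> 'o set \<Rightarrow> ('k, 'o \<times> 'o \<Rightarrow> 'm) module"
  where "orbit_homs C \<beta> \<alpha> = direct_sum (\<beta> \<times> \<alpha>) (\<lambda>(y, x). Hom C y x)"

definition orbit_homs_act ::
  "('g, 'h) monoid_scheme \<Rightarrow> ('g \<Rightarrow> 'o \<Rightarrow> 'o) \<Rightarrow> ('g \<Rightarrow> 'o \<Rightarrow> 'o \<Rightarrow> 'm \<Rightarrow> 'm) \<Rightarrow>
    'o set \<Rightarrow> 'o set \<Rightarrow> 'g \<Rightarrow> ('o \<times> 'o \<Rightarrow> 'm) \<Rightarrow> 'o \<times> 'o \<Rightarrow> 'm"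
  where "orbit_homs_act G act actM \<beta> \<alpha> s u =
    (\<lambda>(y, x) \<in> \<beta> \<times> \<alpha>.
      let y' = act (inv\<^bsub>G\<^esub> s) y; x' = act (inv\<^bsub>G\<^esub> s) x in actM s y' x' (u (y', x')))"

definition quot_submodule ::
  "('k, 'r) ring_scheme \<Rightarrow> ('g, 'h) monoid_scheme \<Rightarrow> ('k, 'o, 'm) lincat \<Rightarrow> ('g \<Rightarrow> 'o \<Rightarrow> 'o) \<Rightarrow>
    ('g \<Rightarrow> 'o \<Rightarrow> 'o \<Rightarrow> 'm \<Rightarrow> 'm) \<Rightarrow> 'o set \<Rightarrow> 'o set \<Rightarrow> ('o \<times> 'o \<Rightarrow> 'm) set"
  where "quot_submodule K G C act actM \<beta> \<alpha> =
    aug_submodule K G (orbit_homs C \<beta> \<alpha>) (orbit_homs_act G act actM \<beta> \<alpha>)"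

text \<open>The group element carrying \<open>y\<close> to \<open>y'\<close>; unique if the action is free and \<open>y\<close>, \<open>y'\<close> lie
  in the same orbit.\<close>

definition transporter :: "('g, 'h) monoid_scheme \<Rightarrow> ('g \<Rightarrow> 'o \<Rightarrow> 'o) \<Rightarrow> 'o \<Rightarrow> 'o \<Rightarrow> 'g"
  where "transporter G act y y' = (THE s. s \<in> carrier G \<and> act s y = y')"

text \<open>The bilinear extension of \<open>(g, f) \<mapsto> g \<circ> sf\<close> to the direct sums, where \<open>f\<close> runs from \<open>x\<close>
  to \<open>y\<close>, \<open>g\<close> from \<open>y'\<close> to \<open>z\<close>, and \<open>sy = y'\<close>.\<close>

definition orbit_comp ::
  "('g, 'h) monoid_scheme \<Rightarrow> ('k, 'o, 'm) lincat \<Rightarrow> ('g \<Rightarrow> 'o \<Rightarrow> 'o) \<Rightarrow>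
    ('g \<Rightarrow> 'o \<Rightarrow> 'o \<Rightarrow> 'm \<Rightarrow> 'm) \<Rightarrow> 'o set \<Rightarrow> 'o set \<Rightarrow> 'o set \<Rightarrow>
    ('o \<times> 'o \<Rightarrow> 'm) \<Rightarrow> ('o \<times> 'o \<Rightarrow> 'm) \<Rightarrow> 'o \<times> 'o \<Rightarrow> 'm"
  where "orbit_comp G C act actM \<gamma> \<beta> \<alpha> v u =
    finsum (orbit_homs C \<gamma> \<alpha>)
      (\<lambda>((z, y'), (y, x)).
        let s = transporter G act y y' in
          single (\<gamma> \<times> \<alpha>) (\<lambda>(z, x). Hom C z x) (z, act s x)
            (Comp C z y' (act s x) (v (z, y')) (actM s y x (u (y, x)))))
      (supp (\<gamma> \<times> \<beta>) (\<lambda>(z, y'). Hom C z y') v \<times> supp (\<beta> \<times> \<alpha>) (\<lambda>(y, x). Hom C y x) u)"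

text \<open>As for products of cosets in the library, operations on cosets are unions over all
  representatives.\<close>

definition quotient_category ::
  "('k, 'r) ring_scheme \<Rightarrow> ('g, 'h) monoid_scheme \<Rightarrow> ('k, 'o, 'm) lincat \<Rightarrow> ('g \<Rightarrow> 'o \<Rightarrow> 'o) \<Rightarrow>
    ('g \<Rightarrow> 'o \<Rightarrow> 'o \<Rightarrow> 'm \<Rightarrow> 'm) \<Rightarrow> ('k, 'o set, ('o \<times> 'o \<Rightarrow> 'm) set) lincat"
  where "quotient_category K G C act actM =
    \<lparr>Obj = orbits G (Obj C) act,
     Hom = (\<lambda>\<beta> \<alpha>. coinvariants K G (orbit_homs C \<beta> \<alpha>) (orbit_homs_act G act actM \<beta> \<alpha>)),
     Comp = (\<lambda>\<gamma> \<beta> \<alpha> Q P. \<Union>v\<in>Q. \<Union>u\<in>P.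
       quot_submodule K G C act actM \<gamma> \<alpha> +>\<^bsub>orbit_homs C \<gamma> \<alpha>\<^esub>
         orbit_comp G C act actM \<gamma> \<beta> \<alpha> v u),
     Id = (\<lambda>\<alpha>. \<Union>x\<in>\<alpha>.
       quot_submodule K G C act actM \<alpha> \<alpha> +>\<^bsub>orbit_homs C \<alpha> \<alpha>\<^esub>
         single (\<alpha> \<times> \<alpha>) (\<lambda>(y, x). Hom C y x) (x, x) (Id C x))\<rparr>"


section \<open>The skew category\<close>

definition skew_homs ::
  "('g, 'h) monoid_scheme \<Rightarrow> ('k, 'o, 'm) lincat \<Rightarrow> ('g \<Rightarrow> 'o \<Rightarrow> 'o) \<Rightarrow> 'o \<Rightarrow> 'o \<Rightarrow>
    ('k, 'g \<Rightarrow> 'm) module"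
  where "skew_homs G C act y x = direct_sum (carrier G) (\<lambda>s. Hom C y (act s x))"

definition skew_comp ::
  "('g, 'h) monoid_scheme \<Rightarrow> ('k, 'o, 'm) lincat \<Rightarrow> ('g \<Rightarrow> 'o \<Rightarrow> 'o) \<Rightarrow>
    ('g \<Rightarrow> 'o \<Rightarrow> 'o \<Rightarrow> 'm \<Rightarrow> 'm) \<Rightarrow> 'o \<Rightarrow> 'o \<Rightarrow> 'o \<Rightarrow> ('g \<Rightarrow> 'm) \<Rightarrow> ('g \<Rightarrow> 'm) \<Rightarrow> 'g \<Rightarrow> 'm"
  where "skew_comp G C act actM z y x v u =
    finsum (skew_homs G C act z x)
      (\<lambda>(t, s).
        single (carrier G) (\<lambda>r. Hom C z (act r x)) (t \<otimes>\<^bsub>G\<^esub> s)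
          (Comp C z (act t y) (act (t \<otimes>\<^bsub>G\<^esub> s) x) (v t) (actM t y (act s x) (u s))))
      (supp (carrier G) (\<lambda>t. Hom C z (act t y)) v \<times> supp (carrier G) (\<lambda>s. Hom C y (act s x)) u)"

definition skew_category ::
  "('g, 'h) monoid_scheme \<Rightarrow> ('k, 'o, 'm) lincat \<Rightarrow> ('g \<Rightarrow> 'o \<Rightarrow> 'o) \<Rightarrow>
    ('g \<Rightarrow> 'o \<Rightarrow> 'o \<Rightarrow> 'm \<Rightarrow> 'm) \<Rightarrow> ('k, 'o, 'g \<Rightarrow> 'm) lincat"
  where "skew_category G C act actM =
    \<lparr>Obj = Obj C,
     Hom = skew_homs G C act,
     Comp = skew_comp G C act actM,
     Id = (\<lambda>x. single (carrier G) (\<lambda>s. Hom C x (act s x)) \<one>\<^bsub>G\<^esub> (Id C x))\<rparr>"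

end

theory Submission
  imports Defs
begin

text \<open>
  For objects \<open>x\<close>, \<open>y\<close> with orbits \<open>\<alpha>\<close>, \<open>\<beta>\<close> there is a linear map from the direct sum of all
  morphism modules between \<open>\<alpha>\<close> and \<open>\<beta>\<close> onto the skew morphisms from \<open>x\<close> to \<open>y\<close>: translate a
  morphism by the group element that takes its target to \<open>y\<close>; its source then is \<open>tx\<close> for a unique
  \<open>t\<close>.  Sending the component at \<open>t\<close> back to the pair \<open>(y, tx)\<close> is a section, and \<open>u\<close> differs
  from its image under the resulting idempotent by translations only, so the kernel is exactly
  \<open>(ker \<epsilon>)\<close> times the direct sum.  Hence the fibres of this map identify the skew morphisms
  from \<open>x\<close> to \<open>y\<close> with the morphisms from \<open>\<alpha>\<close> to \<open>\<beta>\<close> in the quotient, compatibly with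
  composition for all choices of representatives.  This gives a fully faithful functor from the skew
  category to the quotient that sends every object to its orbit, hence is surjective on objects.
\<close>

section \<open>Linear maps and direct sums\<close>

text \<open>The operations of the quotient category are unions over representatives, so checking
  well-definedness, the module axioms and the category axioms there would mean coset computations at
  every step. The axioms are therefore verified only for the skew category, where they reduce to
  homogeneous elements, and are carried to the quotient along bijections of morphism sets that
  respect all operations.

  The map onto skew morphisms depends on the objects \<open>x\<close> and \<open>y\<close>, not
  merely on their orbits. It is built for every pair of objects, so orbit representatives have to be
  chosen only for the functor leading back to the skew category. Freeness makes the group elements
  in this map unique, and it forces those attached to two composable factors to fit together.

  Both compositions are sums over a product of supports, a range that changes with the arguments.
  Treating them as instances of one bilinear extension settles their linearity once and reduces
  identities between them to homogeneous elements.\<close>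

lemma mod_homI:
  assumes "\<And>u. u \<in> carrier M \<Longrightarrow> f u \<in> carrier N"
    and "\<And>u v. \<lbrakk>u \<in> carrier M; v \<in> carrier M\<rbrakk> \<Longrightarrow> f (u \<oplus>\<^bsub>M\<^esub> v) = f u \<oplus>\<^bsub>N\<^esub> f v"
    and "\<And>a u. \<lbrakk>a \<in> carrier K; u \<in> carrier M\<rbrakk> \<Longrightarrow> f (a \<odot>\<^bsub>M\<^esub> u) = a \<odot>\<^bsub>N\<^esub> f u"
  shows "f \<in> mod_hom K M N"
  using assms by (auto simp: mod_hom_def)

lemma mod_hom_closed: "\<lbrakk>f \<in> mod_hom K M N; u \<in> carrier M\<rbrakk> \<Longrightarrow> f u \<in> carrier N"
  by (auto simp: mod_hom_def)

lemma mod_hom_add: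
  "\<lbrakk>f \<in> mod_hom K M N; u \<in> carrier M; v \<in> carrier M\<rbrakk> \<Longrightarrow> f (u \<oplus>\<^bsub>M\<^esub> v) = f u \<oplus>\<^bsub>N\<^esub> f v"
  by (auto simp: mod_hom_def)

lemma mod_hom_smult:
  "\<lbrakk>f \<in> mod_hom K M N; a \<in> carrier K; u \<in> carrier M\<rbrakk> \<Longrightarrow> f (a \<odot>\<^bsub>M\<^esub> u) = a \<odot>\<^bsub>N\<^esub> f u"
  by (auto simp: mod_hom_def)

lemma mod_hom_id: "(\<lambda>u. u) \<in> mod_hom K M M"
  by (auto simp: mod_hom_def)

lemma mod_hom_compose:
  "\<lbrakk>f \<in> mod_hom K L M; g \<in> mod_hom K M N\<rbrakk> \<Longrightarrow> (\<lambda>u. g (f u)) \<in> mod_hom K L N"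
  by (auto simp: mod_hom_def Pi_iff)

lemma mod_hom_zero:
  assumes "module K M" "module K N" and f: "f \<in> mod_hom K M N"
  shows "f \<zero>\<^bsub>M\<^esub> = \<zero>\<^bsub>N\<^esub>"
proof -
  interpret M: module K M by fact
  interpret N: module K N by fact
  have "f (\<zero>\<^bsub>K\<^esub> \<odot>\<^bsub>M\<^esub> \<zero>\<^bsub>M\<^esub>) = \<zero>\<^bsub>K\<^esub> \<odot>\<^bsub>N\<^esub> f \<zero>\<^bsub>M\<^esub>"
    by (rule mod_hom_smult[OF f]) auto
  then show ?thesis
    using mod_hom_closed[OF f, of "\<zero>\<^bsub>M\<^esub>"] by simp
qed

lemma mod_hom_neg:
  assumes "module K M" "module K N" and f: "f \<in> mod_hom K M N" and u: "u \<in> carrier M"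
  shows "f (\<ominus>\<^bsub>M\<^esub> u) = \<ominus>\<^bsub>N\<^esub> f u"
proof -
  interpret M: module K M by fact
  interpret N: module K N by fact
  have "f (\<ominus>\<^bsub>M\<^esub> u) \<oplus>\<^bsub>N\<^esub> f u = f (\<ominus>\<^bsub>M\<^esub> u \<oplus>\<^bsub>M\<^esub> u)"
    using u by (simp add: mod_hom_add[OF f])
  also have "\<dots> = \<zero>\<^bsub>N\<^esub>"
    using u mod_hom_zero[OF assms(1-3)] by (simp add: M.M.l_neg)
  finally show ?thesis
    using u mod_hom_closed[OF f] by (simp add: N.M.minus_equality)
qed

lemma mod_hom_finsum:
  assumes "module K M" "module K N" and f: "f \<in> mod_hom K M N" and w: "w \<in> A \<rightarrow> carrier M"
  shows "f (finsum M w A) = finsum N (\<lambda>i. f (w i)) A"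
proof -
  interpret M: module K M by fact
  interpret N: module K N by fact
  show ?thesis
    using w
  proof (induction A rule: infinite_finite_induct)
    \<comment> \<open>By convention \<open>finsum\<close> over an infinite set is zero, so the claim
      becomes preservation of zero.\<close>
    case (infinite A)
    then show ?case by (simp add: mod_hom_zero[OF assms(1-3)])
  next
    case empty
    then show ?case by (simp add: mod_hom_zero[OF assms(1-3)])
  next
    case (insert i A)
    then show ?case
      by (auto simp: mod_hom_add[OF f] Pi_iff mod_hom_closed[OF f])
  qed
qed

text \<open>Commutativity of \<open>K\<close> lets the fixed scalar \<open>a\<close> move past the
  scalar that tests homogeneity.\<close>

lemma mod_hom_smult_left:
  assumes "module K M" and a: "a \<in> carrier K"
  shows "(\<lambda>u. a \<odot>\<^bsub>M\<^esub> u) \<in> mod_hom K M M"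
proof -
  interpret M: module K M by fact
  have "a \<odot>\<^bsub>M\<^esub> (b \<odot>\<^bsub>M\<^esub> v) = b \<odot>\<^bsub>M\<^esub> (a \<odot>\<^bsub>M\<^esub> v)" if "b \<in> carrier K" "v \<in> carrier M" for b v
    using that a by (metis M.R.m_comm M.smult_assoc1)
  then show ?thesis
    using a by (intro mod_homI) (auto simp: M.smult_r_distr)
qed

lemma (in module) finsum_smult:
  assumes "a \<in> carrier R" and "w \<in> A \<rightarrow> carrier M"
  shows "a \<odot>\<^bsub>M\<^esub> finsum M w A = finsum M (\<lambda>i. a \<odot>\<^bsub>M\<^esub> w i) A"
  using mod_hom_finsum[OF module_axioms module_axioms mod_hom_smult_left[OF module_axioms assms(1)] assms(2)] .

text \<open>Every axiom is pulled back along the bijection, so \<open>N\<close> may be a bare record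
  of operations. This later yields the module structure on the morphism sets of the quotient
  category without coset arithmetic. Preservation of zero is a separate assumption because the zero
  of \<open>N\<close> is just a field of the record, not yet tied to its addition.\<close>

lemma module_transport:
  assumes "module K M" and p: "bij_betw p (carrier M) (carrier N)"
    and zero: "p \<zero>\<^bsub>M\<^esub> = \<zero>\<^bsub>N\<^esub>"
    and add: "\<And>u v. \<lbrakk>u \<in> carrier M; v \<in> carrier M\<rbrakk> \<Longrightarrow> p (u \<oplus>\<^bsub>M\<^esub> v) = p u \<oplus>\<^bsub>N\<^esub> p v"
    and smult: "\<And>a u. \<lbrakk>a \<in> carrier K; u \<in> carrier M\<rbrakk> \<Longrightarrow> p (a \<odot>\<^bsub>M\<^esub> u) = a \<odot>\<^bsub>N\<^esub> p u"
  shows "module K N"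
proof -
  interpret M: module K M by fact
  have cN: "carrier N = p ` carrier M"
    using p by (auto simp: bij_betw_def)
  show ?thesis
  proof (rule moduleI)
    show "abelian_group N"
    proof (rule abelian_groupI)
      fix u assume "u \<in> carrier N"
      then obtain v where v: "v \<in> carrier M" "u = p v" by (auto simp: cN)
      then have "p (\<ominus>\<^bsub>M\<^esub> v) \<oplus>\<^bsub>N\<^esub> u = \<zero>\<^bsub>N\<^esub>"
        by (metis M.M.a_inv_closed M.M.l_neg add zero)
      then show "\<exists>w\<in>carrier N. w \<oplus>\<^bsub>N\<^esub> u = \<zero>\<^bsub>N\<^esub>"
        using v by (auto simp: cN)
    qed (auto simp: cN add[symmetric] zero[symmetric] M.M.a_assoc intro: arg_cong[OF M.M.a_comm])
  qed (auto simp: cN add[symmetric] smult[symmetric] M.smult_l_distr M.smult_r_distr M.smult_assoc1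
      intro: M.is_cring)
qed

lemma inv_into_mod_hom:
  assumes "module K M" and "bij_betw p (carrier M) (carrier N)" and p: "p \<in> mod_hom K M N"
  shows "inv_into (carrier M) p \<in> mod_hom K N M"
proof -
  interpret M: module K M by fact
  note inj = bij_betw_imp_inj_on[OF assms(2)]
  have cN: "carrier N = p ` carrier M"
    using assms(2) by (auto simp: bij_betw_def)
  show ?thesis
    by (rule mod_homI)
      (auto simp: cN mod_hom_add[OF p, symmetric] mod_hom_smult[OF p, symmetric] inv_into_f_f[OF inj])
qed

section \<open>Direct sums of families of modules\<close>

lemma finite_supp: "u \<in> carrier (direct_sum I M) \<Longrightarrow> finite (supp I M u)"
  by (simp add: direct_sum_def supp_def)

lemma direct_sum_apply: "\<lbrakk>u \<in> carrier (direct_sum I M); i \<in> I\<rbrakk> \<Longrightarrow> u i \<in> carrier (M i)"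
  by (auto simp: direct_sum_def)

lemma direct_sum_simps:
  "\<zero>\<^bsub>direct_sum I M\<^esub> = (\<lambda>i\<in>I. \<zero>\<^bsub>M i\<^esub>)"
  "u \<oplus>\<^bsub>direct_sum I M\<^esub> v = (\<lambda>i\<in>I. u i \<oplus>\<^bsub>M i\<^esub> v i)"
  "a \<odot>\<^bsub>direct_sum I M\<^esub> u = (\<lambda>i\<in>I. a \<odot>\<^bsub>M i\<^esub> u i)"
  by (simp_all add: direct_sum_def)

lemma direct_sum_carrierI:
  assumes "u \<in> (\<Pi>\<^sub>E i\<in>I. carrier (M i))" and "finite A"
    and "\<And>i. \<lbrakk>i \<in> I; i \<notin> A\<rbrakk> \<Longrightarrow> u i = \<zero>\<^bsub>M i\<^esub>"
  shows "u \<in> carrier (direct_sum I M)"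
proof -
  have "{i \<in> I. u i \<noteq> \<zero>\<^bsub>M i\<^esub>} \<subseteq> A"
    using assms(3) by auto
  then show ?thesis
    using assms(1,2) finite_subset by (auto simp: direct_sum_def)
qed

lemma direct_sum_eqI:
  assumes "u \<in> carrier (direct_sum I M)" "v \<in> carrier (direct_sum I M)" "\<And>i. i \<in> I \<Longrightarrow> u i = v i"
  shows "u = v"
  using assms by (auto simp: direct_sum_def intro: PiE_ext)

locale module_family = K: cring K
  for K :: "('k, 'r) ring_scheme" and I :: "'i set" and M :: "'i \<Rightarrow> ('k, 'm, 'c) module_scheme" +
  assumes module: "i \<in> I \<Longrightarrow> module K (M i)"
begin

abbreviation "DS \<equiv> direct_sum I M"

lemma supp_le: "\<lbrakk>i \<in> I; i \<notin> supp I M u\<rbrakk> \<Longrightarrow> u i = \<zero>\<^bsub>M i\<^esub>"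
  by (simp add: supp_def)

lemma zero_closed: "i \<in> I \<Longrightarrow> \<zero>\<^bsub>M i\<^esub> \<in> carrier (M i)"
  by (metis module module.axioms(2) abelian_group_def abelian_monoid.zero_closed)

lemma direct_sum_zero_closed: "\<zero>\<^bsub>DS\<^esub> \<in> carrier DS"
  by (rule direct_sum_carrierI[where A = "{}"]) (auto simp: direct_sum_simps zero_closed)

lemma direct_sum_add_closed:
  assumes "u \<in> carrier DS" "v \<in> carrier DS"
  shows "u \<oplus>\<^bsub>DS\<^esub> v \<in> carrier DS"
proof (rule direct_sum_carrierI[where A = "supp I M u \<union> supp I M v"])
  show "u \<oplus>\<^bsub>DS\<^esub> v \<in> (\<Pi>\<^sub>E i\<in>I. carrier (M i))"
  proof -
    have "u i \<oplus>\<^bsub>M i\<^esub> v i \<in> carrier (M i)" if "i \<in> I" for i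
    proof -
      interpret module K "M i" by (rule module) fact
      show ?thesis using assms that by (simp add: direct_sum_apply)
    qed
    then show ?thesis by (auto simp: direct_sum_simps)
  qed
next
  fix i assume i: "i \<in> I" "i \<notin> supp I M u \<union> supp I M v"
  interpret module K "M i" by (rule module) fact
  show "(u \<oplus>\<^bsub>DS\<^esub> v) i = \<zero>\<^bsub>M i\<^esub>"
    using i by (simp add: direct_sum_simps supp_le)
qed (use assms in \<open>auto intro: finite_supp\<close>)

lemma direct_sum_smult_closed:
  assumes "a \<in> carrier K" "u \<in> carrier DS"
  shows "a \<odot>\<^bsub>DS\<^esub> u \<in> carrier DS"
proof (rule direct_sum_carrierI[where A = "supp I M u"])
  show "a \<odot>\<^bsub>DS\<^esub> u \<in> (\<Pi>\<^sub>E i\<in>I. carrier (M i))"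
  proof -
    have "a \<odot>\<^bsub>M i\<^esub> u i \<in> carrier (M i)" if "i \<in> I" for i
    proof -
      interpret module K "M i" by (rule module) fact
      show ?thesis using assms that by (simp add: direct_sum_apply)
    qed
    then show ?thesis by (auto simp: direct_sum_simps)
  qed
next
  fix i assume i: "i \<in> I" "i \<notin> supp I M u"
  interpret module K "M i" by (rule module) fact
  show "(a \<odot>\<^bsub>DS\<^esub> u) i = \<zero>\<^bsub>M i\<^esub>"
    using i assms by (simp add: direct_sum_simps supp_le)
qed (use assms in \<open>auto intro: finite_supp\<close>)

lemmas direct_sum_closed = direct_sum_zero_closed direct_sum_add_closed direct_sum_smult_closed

lemma direct_sum_module: "module K DS"
proof (rule moduleI)
  show "abelian_group DS"
  proof (rule abelian_groupI)
    fix u assume u: "u \<in> carrier DS"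
    let ?v = "\<lambda>i\<in>I. \<ominus>\<^bsub>M i\<^esub> u i"
    have "?v \<in> carrier DS"
    proof (rule direct_sum_carrierI[where A = "supp I M u"])
      have "\<ominus>\<^bsub>M i\<^esub> u i \<in> carrier (M i)" if "i \<in> I" for i
      proof -
        interpret module K "M i" by (rule module) fact
        show ?thesis using u that by (simp add: direct_sum_apply)
      qed
      then show "?v \<in> (\<Pi>\<^sub>E i\<in>I. carrier (M i))" by auto
    next
      fix i assume i: "i \<in> I" "i \<notin> supp I M u"
      interpret module K "M i" by (rule module) fact
      show "?v i = \<zero>\<^bsub>M i\<^esub>"
        using i by (simp add: supp_le)
    qed (use u in \<open>auto intro: finite_supp\<close>)
    moreover have "?v \<oplus>\<^bsub>DS\<^esub> u = \<zero>\<^bsub>DS\<^esub>"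
    proof -
      have "\<ominus>\<^bsub>M i\<^esub> u i \<oplus>\<^bsub>M i\<^esub> u i = \<zero>\<^bsub>M i\<^esub>" if "i \<in> I" for i
      proof -
        interpret module K "M i" by (rule module) fact
        show ?thesis using u that by (simp add: direct_sum_apply M.l_neg)
      qed
      then show ?thesis by (auto simp: direct_sum_simps)
    qed
    ultimately show "\<exists>v\<in>carrier DS. v \<oplus>\<^bsub>DS\<^esub> u = \<zero>\<^bsub>DS\<^esub>" by blast
  next
    fix u v w assume uvw: "u \<in> carrier DS" "v \<in> carrier DS" "w \<in> carrier DS"
    show "(u \<oplus>\<^bsub>DS\<^esub> v) \<oplus>\<^bsub>DS\<^esub> w = u \<oplus>\<^bsub>DS\<^esub> (v \<oplus>\<^bsub>DS\<^esub> w)"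
    proof (rule direct_sum_eqI[of _ I M])
      fix i assume i: "i \<in> I"
      interpret module K "M i" by (rule module) fact
      show "(u \<oplus>\<^bsub>DS\<^esub> v \<oplus>\<^bsub>DS\<^esub> w) i = (u \<oplus>\<^bsub>DS\<^esub> (v \<oplus>\<^bsub>DS\<^esub> w)) i"
        using i uvw by (simp add: direct_sum_simps direct_sum_apply M.a_assoc)
    qed (use uvw direct_sum_closed in auto)
  next
    fix u v assume uv: "u \<in> carrier DS" "v \<in> carrier DS"
    show "u \<oplus>\<^bsub>DS\<^esub> v = v \<oplus>\<^bsub>DS\<^esub> u"
    proof (rule direct_sum_eqI[of _ I M])
      fix i assume i: "i \<in> I"
      interpret module K "M i" by (rule module) fact
      show "(u \<oplus>\<^bsub>DS\<^esub> v) i = (v \<oplus>\<^bsub>DS\<^esub> u) i"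
        using i uv by (simp add: direct_sum_simps direct_sum_apply M.a_comm)
    qed (use uv direct_sum_closed in auto)
  next
    fix u assume u: "u \<in> carrier DS"
    show "\<zero>\<^bsub>DS\<^esub> \<oplus>\<^bsub>DS\<^esub> u = u"
    proof (rule direct_sum_eqI[of _ I M])
      fix i assume i: "i \<in> I"
      interpret module K "M i" by (rule module) fact
      show "(\<zero>\<^bsub>DS\<^esub> \<oplus>\<^bsub>DS\<^esub> u) i = u i"
        using i u by (simp add: direct_sum_simps direct_sum_apply)
    qed (use u direct_sum_closed in auto)
  qed (use direct_sum_closed in auto)
next
  fix a b u assume cl: "a \<in> carrier K" "b \<in> carrier K" "u \<in> carrier DS"
  show "(a \<oplus>\<^bsub>K\<^esub> b) \<odot>\<^bsub>DS\<^esub> u = a \<odot>\<^bsub>DS\<^esub> u \<oplus>\<^bsub>DS\<^esub> b \<odot>\<^bsub>DS\<^esub> u"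
  proof (rule direct_sum_eqI[of _ I M])
    fix i assume i: "i \<in> I"
    interpret module K "M i" by (rule module) fact
    show "((a \<oplus>\<^bsub>K\<^esub> b) \<odot>\<^bsub>DS\<^esub> u) i = (a \<odot>\<^bsub>DS\<^esub> u \<oplus>\<^bsub>DS\<^esub> b \<odot>\<^bsub>DS\<^esub> u) i"
      using i cl by (simp add: direct_sum_simps direct_sum_apply smult_l_distr)
  qed (use cl direct_sum_closed in auto)
next
  fix a u v assume cl: "a \<in> carrier K" "u \<in> carrier DS" "v \<in> carrier DS"
  show "a \<odot>\<^bsub>DS\<^esub> (u \<oplus>\<^bsub>DS\<^esub> v) = a \<odot>\<^bsub>DS\<^esub> u \<oplus>\<^bsub>DS\<^esub> a \<odot>\<^bsub>DS\<^esub> v"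
  proof (rule direct_sum_eqI[of _ I M])
    fix i assume i: "i \<in> I"
    interpret module K "M i" by (rule module) fact
    show "(a \<odot>\<^bsub>DS\<^esub> (u \<oplus>\<^bsub>DS\<^esub> v)) i = (a \<odot>\<^bsub>DS\<^esub> u \<oplus>\<^bsub>DS\<^esub> a \<odot>\<^bsub>DS\<^esub> v) i"
      using i cl by (simp add: direct_sum_simps direct_sum_apply smult_r_distr)
  qed (use cl direct_sum_closed in auto)
next
  fix a b u assume cl: "a \<in> carrier K" "b \<in> carrier K" "u \<in> carrier DS"
  show "(a \<otimes>\<^bsub>K\<^esub> b) \<odot>\<^bsub>DS\<^esub> u = a \<odot>\<^bsub>DS\<^esub> (b \<odot>\<^bsub>DS\<^esub> u)"
  proof (rule direct_sum_eqI[of _ I M])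
    fix i assume i: "i \<in> I"
    interpret module K "M i" by (rule module) fact
    show "((a \<otimes>\<^bsub>K\<^esub> b) \<odot>\<^bsub>DS\<^esub> u) i = (a \<odot>\<^bsub>DS\<^esub> (b \<odot>\<^bsub>DS\<^esub> u)) i"
      using i cl by (simp add: direct_sum_simps direct_sum_apply smult_assoc1)
  qed (use cl direct_sum_closed in auto)
next
  fix u assume cl: "u \<in> carrier DS"
  show "\<one>\<^bsub>K\<^esub> \<odot>\<^bsub>DS\<^esub> u = u"
  proof (rule direct_sum_eqI[of _ I M])
    fix i assume i: "i \<in> I"
    interpret module K "M i" by (rule module) fact
    show "(\<one>\<^bsub>K\<^esub> \<odot>\<^bsub>DS\<^esub> u) i = u i"
      using i cl by (simp add: direct_sum_simps direct_sum_apply)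
  qed (use cl direct_sum_closed in auto)
qed (use direct_sum_smult_closed K.cring_axioms in auto)

sublocale DS: module K DS
  by (rule direct_sum_module)

lemma single_closed:
  assumes "i \<in> I" "m \<in> carrier (M i)"
  shows "single I M i m \<in> carrier DS"
  by (rule direct_sum_carrierI[where A = "{i}"]) (use assms zero_closed in \<open>auto simp: single_def\<close>)

lemma single_mod_hom:
  assumes i: "i \<in> I"
  shows "single I M i \<in> mod_hom K (M i) DS"
proof (rule mod_homI)
  interpret Mi: module K "M i" by (rule module) fact
  fix u v assume uv: "u \<in> carrier (M i)" "v \<in> carrier (M i)"
  show "single I M i (u \<oplus>\<^bsub>M i\<^esub> v) = single I M i u \<oplus>\<^bsub>DS\<^esub> single I M i v"
  proof (rule direct_sum_eqI[of _ I M])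
    fix j assume j: "j \<in> I"
    interpret Mj: module K "M j" by (rule module) fact
    show "single I M i (u \<oplus>\<^bsub>M i\<^esub> v) j = (single I M i u \<oplus>\<^bsub>DS\<^esub> single I M i v) j"
      using j uv by (simp add: single_def direct_sum_simps)
  qed (use i uv in \<open>auto intro!: single_closed direct_sum_add_closed\<close>)
next
  interpret Mi: module K "M i" by (rule module) fact
  fix a u assume au: "a \<in> carrier K" "u \<in> carrier (M i)"
  show "single I M i (a \<odot>\<^bsub>M i\<^esub> u) = a \<odot>\<^bsub>DS\<^esub> single I M i u"
  proof (rule direct_sum_eqI[of _ I M])
    fix j assume j: "j \<in> I"
    interpret Mj: module K "M j" by (rule module) fact
    show "single I M i (a \<odot>\<^bsub>M i\<^esub> u) j = (a \<odot>\<^bsub>DS\<^esub> single I M i u) j"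
      using j au by (simp add: single_def direct_sum_simps)
  qed (use i au in \<open>auto intro!: single_closed direct_sum_smult_closed\<close>)
qed (use i single_closed in auto)

lemma supp_single: "supp I M (single I M i m) \<subseteq> {i}"
  by (auto simp: supp_def single_def)

text \<open>Components are stripped off one at a time: an element of finite support is a finite sum
  of homogeneous ones.\<close>

lemma direct_sum_induct [consumes 1, case_names zero single add]:
  assumes u: "u \<in> carrier DS"
    and zero: "P \<zero>\<^bsub>DS\<^esub>"
    and single: "\<And>i m. \<lbrakk>i \<in> I; m \<in> carrier (M i)\<rbrakk> \<Longrightarrow> P (single I M i m)"
    and add: "\<And>v w. \<lbrakk>v \<in> carrier DS; w \<in> carrier DS; P v; P w\<rbrakk> \<Longrightarrow> P (v \<oplus>\<^bsub>DS\<^esub> w)"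
  shows "P u"
proof -
  \<comment> \<open>Stating the claim for all finite \<open>A\<close> containing the support makes
    the induction step uniform: the index \<open>i\<close> is removed from \<open>A\<close> whether
    or not \<open>v\<close> vanishes there.\<close>
  have "P v" if "finite A" "v \<in> carrier DS" "supp I M v \<subseteq> A" for A v
    using that
  proof (induction A arbitrary: v rule: finite_induct)
    case empty
    then have "v = \<zero>\<^bsub>DS\<^esub>"
      by (intro direct_sum_eqI[OF _ direct_sum_zero_closed])
        (auto simp: direct_sum_simps supp_def)
    then show ?case using zero by simp
  next
    case (insert i A)
    show ?case
    proof (cases "i \<in> I")
      case False
      then show ?thesis using insert by (auto simp: supp_def)
    next
      case i: True
      \<comment> \<open>This is \<open>v\<close> with its component at \<open>i\<close> erased; its
        support lies in \<open>A\<close>, and adding \<open>single I M i (v i)\<close> recovers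
        \<open>v\<close>.\<close>
      let ?w = "\<lambda>j\<in>I. if j = i then \<zero>\<^bsub>M j\<^esub> else v j"
      have w: "?w \<in> carrier DS"
        by (rule direct_sum_carrierI[OF _ insert.hyps(1)])
          (use insert zero_closed in \<open>auto simp: direct_sum_apply supp_def\<close>)
      have "supp I M ?w \<subseteq> A"
        using insert by (auto simp: supp_def)
      then have "P ?w"
        using insert w by blast
      moreover have s: "single I M i (v i) \<in> carrier DS"
        using i insert by (simp add: single_closed direct_sum_apply)
      moreover have "v = single I M i (v i) \<oplus>\<^bsub>DS\<^esub> ?w"
      proof (rule direct_sum_eqI[of _ I M])
        fix j assume j: "j \<in> I"
        interpret Mi: module K "M i" by (rule module) fact
        interpret Mj: module K "M j" by (rule module) fact
        show "v j = (single I M i (v i) \<oplus>\<^bsub>DS\<^esub> ?w) j"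
          using j i direct_sum_apply[OF insert.prems(1) j] direct_sum_apply[OF insert.prems(1) i]
          by (simp add: single_def direct_sum_simps)
      qed (use s w insert direct_sum_add_closed in auto)
      ultimately show ?thesis
        using add[OF s w] single[OF i direct_sum_apply[OF insert.prems(1) i]] by simp
    qed
  qed
  from this[OF finite_supp[OF u] u order_refl] show ?thesis .
qed

text \<open>The homogeneous elements generate the direct sum. Identities between multilinear
  expressions are later reduced to them by applying this to one argument after another.\<close>

lemma mod_hom_eqI:
  assumes N: "module K N" and f: "f \<in> mod_hom K DS N" and g: "g \<in> mod_hom K DS N"
    and eq: "\<And>i m. \<lbrakk>i \<in> I; m \<in> carrier (M i)\<rbrakk> \<Longrightarrow> f (single I M i m) = g (single I M i m)"
    and u: "u \<in> carrier DS"
  shows "f u = g u"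
  using u
proof (induction u rule: direct_sum_induct)
  case zero
  then show ?case by (simp add: mod_hom_zero[OF direct_sum_module N f] mod_hom_zero[OF direct_sum_module N g])
next
  case (add v w)
  then show ?case by (simp add: mod_hom_add[OF f] mod_hom_add[OF g])
qed (simp add: eq)

end

section \<open>Linear and bilinear extension from the summands\<close>

definition linear_ext ::
  "'i set \<Rightarrow> ('i \<Rightarrow> ('k, 'm, 'c) module_scheme) \<Rightarrow> ('k, 'n, 'd) module_scheme \<Rightarrow>
    ('i \<Rightarrow> 'm \<Rightarrow> 'n) \<Rightarrow> ('i \<Rightarrow> 'm) \<Rightarrow> 'n"
  where "linear_ext I M N l u = finsum N (\<lambda>i. l i (u i)) (supp I M u)"

text \<open>The range of summation is written as a product of supports so that
  \<open>skew_comp\<close> and \<open>orbit_comp\<close> are both literal instances.\<close>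

definition bilinear_ext ::
  "'i set \<Rightarrow> ('i \<Rightarrow> ('k, 'm, 'c) module_scheme) \<Rightarrow> 'j set \<Rightarrow> ('j \<Rightarrow> ('k, 'n, 'd) module_scheme) \<Rightarrow>
    ('k, 'p, 'e) module_scheme \<Rightarrow> ('i \<Rightarrow> 'j \<Rightarrow> 'm \<Rightarrow> 'n \<Rightarrow> 'p) \<Rightarrow> ('i \<Rightarrow> 'm) \<Rightarrow> ('j \<Rightarrow> 'n) \<Rightarrow> 'p"
  where "bilinear_ext I M J N P b v u =
    finsum P (\<lambda>(i, j). b i j (v i) (u j)) (supp I M v \<times> supp J N u)"

context module_family
begin

text \<open>The difficulty is that the range of summation depends on \<open>u\<close>. Terms at
  indices where \<open>u\<close> vanishes are zero by linearity, so all ranges can be enlarged to a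
  common finite set before the sums are compared term by term. The spare finite factor
  \<open>B\<close> serves two purposes: a one-point set gives linear extensions, the support of a
  fixed second argument gives bilinear ones.\<close>

lemma finsum_ext_mod_hom:
  assumes N: "module K N" and B: "finite B"
    and l: "\<And>i j. \<lbrakk>i \<in> I; j \<in> B\<rbrakk> \<Longrightarrow> l i j \<in> mod_hom K (M i) N"
  shows "(\<lambda>u. finsum N (\<lambda>(i, j). l i j (u i)) (supp I M u \<times> B)) \<in> mod_hom K DS N"
proof -
  interpret N: module K N by fact
  have closed: "l i j (u i) \<in> carrier N" if "u \<in> carrier DS" "i \<in> I" "j \<in> B" for u i j
    using that l mod_hom_closed direct_sum_apply by metis
  have ext: "finsum N (\<lambda>(i, j). l i j (u i)) (supp I M u \<times> B) =
      finsum N (\<lambda>(i, j). l i j (u i)) (A \<times> B)"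
    if "u \<in> carrier DS" "finite A" "supp I M u \<subseteq> A" "A \<subseteq> I" for u A
  proof (rule N.add.finprod_mono_neutral_cong_left)
    fix p assume "p \<in> A \<times> B - supp I M u \<times> B"
    then obtain i j where p: "p = (i, j)" "i \<in> I" "j \<in> B" "i \<notin> supp I M u"
      using \<open>A \<subseteq> I\<close> by auto
    then show "(case p of (i, j) \<Rightarrow> l i j (u i)) = \<zero>\<^bsub>N\<^esub>"
      by (simp add: supp_le mod_hom_zero[OF module N l])
  qed (use that B closed in auto)
  have sI: "supp I M u \<subseteq> I" for u by (auto simp: supp_def)
  show ?thesis
  proof (rule mod_homI)
    fix u assume "u \<in> carrier DS"
    then show "finsum N (\<lambda>(i, j). l i j (u i)) (supp I M u \<times> B) \<in> carrier N"
      using sI closed by (intro N.finsum_closed) (auto simp: subset_iff)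
  next
    fix u v assume uv: "u \<in> carrier DS" "v \<in> carrier DS"
    \<comment> \<open>The support of the sum may be smaller than the union of the other two because
      of cancellation; all three sums are moved to this common range.\<close>
    define A where "A = supp I M u \<union> supp I M v \<union> supp I M (u \<oplus>\<^bsub>DS\<^esub> v)"
    have A: "finite A" "A \<subseteq> I"
      using uv finite_supp direct_sum_add_closed sI by (auto simp: A_def)
    have "supp I M u \<subseteq> A" "supp I M v \<subseteq> A" "supp I M (u \<oplus>\<^bsub>DS\<^esub> v) \<subseteq> A"
      by (auto simp: A_def)
    note e = ext[OF uv(1) A(1) this(1) A(2)] ext[OF uv(2) A(1) this(2) A(2)]
      ext[OF direct_sum_add_closed[OF uv] A(1) this(3) A(2)]
    have "l i j ((u \<oplus>\<^bsub>DS\<^esub> v) i) = l i j (u i) \<oplus>\<^bsub>N\<^esub> l i j (v i)" if "i \<in> A" "j \<in> B" for i j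
      using that A uv by (auto simp: direct_sum_simps mod_hom_add[OF l] direct_sum_apply subset_iff)
    then have "finsum N (\<lambda>(i, j). l i j ((u \<oplus>\<^bsub>DS\<^esub> v) i)) (A \<times> B) =
        finsum N (\<lambda>p. (case p of (i, j) \<Rightarrow> l i j (u i)) \<oplus>\<^bsub>N\<^esub> (case p of (i, j) \<Rightarrow> l i j (v i))) (A \<times> B)"
      using A uv closed by (intro N.finsum_cong') (auto simp: subset_iff)
    also have "\<dots> = finsum N (\<lambda>(i, j). l i j (u i)) (A \<times> B) \<oplus>\<^bsub>N\<^esub>
        finsum N (\<lambda>(i, j). l i j (v i)) (A \<times> B)"
      using A uv closed by (intro N.finsum_addf) (auto simp: subset_iff)
    finally show "finsum N (\<lambda>(i, j). l i j ((u \<oplus>\<^bsub>DS\<^esub> v) i)) (supp I M (u \<oplus>\<^bsub>DS\<^esub> v) \<times> B) =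
        finsum N (\<lambda>(i, j). l i j (u i)) (supp I M u \<times> B) \<oplus>\<^bsub>N\<^esub>
        finsum N (\<lambda>(i, j). l i j (v i)) (supp I M v \<times> B)"
      by (simp only: e)
  next
    fix a u assume au: "a \<in> carrier K" "u \<in> carrier DS"
    define A where "A = supp I M u \<union> supp I M (a \<odot>\<^bsub>DS\<^esub> u)"
    have A: "finite A" "A \<subseteq> I"
      using au finite_supp direct_sum_smult_closed sI by (auto simp: A_def)
    have "supp I M u \<subseteq> A" "supp I M (a \<odot>\<^bsub>DS\<^esub> u) \<subseteq> A"
      by (auto simp: A_def)
    note e = ext[OF au(2) A(1) this(1) A(2)]
      ext[OF direct_sum_smult_closed[OF au] A(1) this(2) A(2)]
    have "l i j ((a \<odot>\<^bsub>DS\<^esub> u) i) = a \<odot>\<^bsub>N\<^esub> l i j (u i)" if "i \<in> A" "j \<in> B" for i j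
      using that A au by (auto simp: direct_sum_simps mod_hom_smult[OF l] direct_sum_apply subset_iff)
    then have "finsum N (\<lambda>(i, j). l i j ((a \<odot>\<^bsub>DS\<^esub> u) i)) (A \<times> B) =
        finsum N (\<lambda>p. a \<odot>\<^bsub>N\<^esub> (case p of (i, j) \<Rightarrow> l i j (u i))) (A \<times> B)"
      using A au closed by (intro N.finsum_cong') (auto simp: subset_iff)
    also have "\<dots> = a \<odot>\<^bsub>N\<^esub> finsum N (\<lambda>(i, j). l i j (u i)) (A \<times> B)"
      using A au closed by (intro N.finsum_smult[symmetric]) (auto simp: subset_iff)
    finally show "finsum N (\<lambda>(i, j). l i j ((a \<odot>\<^bsub>DS\<^esub> u) i)) (supp I M (a \<odot>\<^bsub>DS\<^esub> u) \<times> B) =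
        a \<odot>\<^bsub>N\<^esub> finsum N (\<lambda>(i, j). l i j (u i)) (supp I M u \<times> B)"
      by (simp only: e)
  qed
qed

text \<open>A dummy one-point factor in the index set brings the sum into the shape treated by
  \<open>finsum_ext_mod_hom\<close>.\<close>

lemma linear_ext_conv:
  assumes N: "module K N" and l: "\<And>i. i \<in> I \<Longrightarrow> l i \<in> mod_hom K (M i) N"
    and u: "u \<in> carrier DS"
  shows "linear_ext I M N l u = finsum N (\<lambda>(i, j :: unit). l i (u i)) (supp I M u \<times> {()})"
proof -
  interpret N: module K N by fact
  have "finsum N (\<lambda>(i, j :: unit). l i (u i)) ((\<lambda>i. (i, ())) ` supp I M u) =
      finsum N (\<lambda>i. l i (u i)) (supp I M u)"
  proof (subst N.finsum_reindex)
    have "l i (u i) \<in> carrier N" if "i \<in> supp I M u" for i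
      using that u mod_hom_closed[OF l] direct_sum_apply by (fastforce simp: supp_def)
    then show "(\<lambda>(i, j :: unit). l i (u i)) \<in> (\<lambda>i. (i, ())) ` supp I M u \<rightarrow> carrier N"
      by auto
  qed (auto simp: inj_on_def)
  moreover have "(\<lambda>i. (i, ())) ` supp I M u = supp I M u \<times> {()}" by auto
  ultimately show ?thesis by (simp add: linear_ext_def)
qed

lemma linear_ext_mod_hom:
  assumes N: "module K N" and l: "\<And>i. i \<in> I \<Longrightarrow> l i \<in> mod_hom K (M i) N"
  shows "linear_ext I M N l \<in> mod_hom K DS N"
proof -
  have *: "(\<lambda>u. finsum N (\<lambda>(i, j :: unit). l i (u i)) (supp I M u \<times> {()})) \<in> mod_hom K DS N"
    using finsum_ext_mod_hom[OF N, of "{()}" "\<lambda>i j. l i"] l by simp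
  show ?thesis
    by (rule mod_homI)
      (use mod_hom_closed[OF *] mod_hom_add[OF *] mod_hom_smult[OF *] in
        \<open>simp_all add: linear_ext_conv[OF N l] direct_sum_add_closed direct_sum_smult_closed\<close>)
qed

text \<open>The support is \<open>{i}\<close> or, when \<open>m\<close> is zero, empty. In the
  latter case \<open>l i m\<close> vanishes by linearity, so summing over \<open>{i}\<close> is
  right either way.\<close>

lemma finsum_over_single:
  assumes N: "module K N" and i: "i \<in> I" and m: "m \<in> carrier (M i)" 
    and l: "l i \<in> mod_hom K (M i) N"
  shows "finsum N (\<lambda>i'. l i' (single I M i m i')) (supp I M (single I M i m)) = l i m"
proof -
  interpret N: module K N by fact
  have "finsum N (\<lambda>i'. l i' (single I M i m i')) (supp I M (single I M i m)) =
      finsum N (\<lambda>i'. l i m) {i}"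
    by (rule N.add.finprod_mono_neutral_cong_left)
      (use i m supp_single[of i m] mod_hom_zero[OF module[OF i] N l] mod_hom_closed[OF l] in
        \<open>auto simp: supp_def single_def split: if_splits\<close>)
  then show ?thesis
    using mod_hom_closed[OF l m] by (simp add: N.finsum_insert[of "{}"])
qed

lemma linear_ext_single:
  assumes "module K N" and "\<And>i. i \<in> I \<Longrightarrow> l i \<in> mod_hom K (M i) N"
    and "i \<in> I" "m \<in> carrier (M i)"
  shows "linear_ext I M N l (single I M i m) = l i m"
  unfolding linear_ext_def by (rule finsum_over_single) (use assms in auto)

end

locale bilinear_family =
  M: module_family K I M + N: module_family K J N + P: module K P
  for K :: "('k, 'r) ring_scheme" and I :: "'i set" and M :: "'i \<Rightarrow> ('k, 'm, 'c) module_scheme"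
    and J :: "'j set" and N :: "'j \<Rightarrow> ('k, 'n, 'd) module_scheme"
    and P :: "('k, 'p, 'e) module_scheme" +
  fixes b :: "'i \<Rightarrow> 'j \<Rightarrow> 'm \<Rightarrow> 'n \<Rightarrow> 'p"
  assumes linear_left:
      "\<lbrakk>i \<in> I; j \<in> J; n \<in> carrier (N j)\<rbrakk> \<Longrightarrow> (\<lambda>m. b i j m n) \<in> mod_hom K (M i) P"
    and linear_right:
      "\<lbrakk>i \<in> I; j \<in> J; m \<in> carrier (M i)\<rbrakk> \<Longrightarrow> (\<lambda>n. b i j m n) \<in> mod_hom K (N j) P"
begin

abbreviation "ext \<equiv> bilinear_ext I M J N P b"

lemma ext_linear_left:
  assumes u: "u \<in> carrier N.DS"
  shows "(\<lambda>v. ext v u) \<in> mod_hom K M.DS P"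
  unfolding bilinear_ext_def
  by (rule M.finsum_ext_mod_hom)
    (use u finite_supp[OF u] in \<open>auto simp: supp_def direct_sum_apply P.module_axioms intro!: linear_left\<close>)

text \<open>In \<open>finsum_ext_mod_hom\<close> it is the first index whose range varies, so the
  double sum is reindexed along \<open>prod.swap\<close> before that result applies.\<close>

lemma ext_linear_right:
  assumes v: "v \<in> carrier M.DS"
  shows "ext v \<in> mod_hom K N.DS P"
proof -
  have *: "(\<lambda>u. finsum P (\<lambda>(j, i). b i j (v i) (u j)) (supp J N u \<times> supp I M v)) \<in> mod_hom K N.DS P"
    by (rule N.finsum_ext_mod_hom)
      (use v finite_supp[OF v] in \<open>auto simp: supp_def direct_sum_apply P.module_axioms intro!: linear_right\<close>)
  have eq: "ext v u = finsum P (\<lambda>(j, i). b i j (v i) (u j)) (supp J N u \<times> supp I M v)"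
    if "u \<in> carrier N.DS" for u
  proof -
    have "finsum P (\<lambda>(i, j). b i j (v i) (u j)) (prod.swap ` (supp J N u \<times> supp I M v)) =
        finsum P (\<lambda>q. case prod.swap q of (i, j) \<Rightarrow> b i j (v i) (u j)) (supp J N u \<times> supp I M v)"
      by (rule P.finsum_reindex)
        (use v that in \<open>auto simp: supp_def direct_sum_apply intro!: mod_hom_closed[OF linear_right]\<close>)
    then show ?thesis
      by (simp add: bilinear_ext_def product_swap case_prod_beta')
  qed
  show ?thesis
    by (rule mod_homI)
      (use mod_hom_closed[OF *] mod_hom_add[OF *] mod_hom_smult[OF *] in
        \<open>simp_all add: eq N.direct_sum_add_closed N.direct_sum_smult_closed\<close>)
qed

lemma ext_single:
  assumes i: "i \<in> I" "m \<in> carrier (M i)" and j: "j \<in> J" "n \<in> carrier (N j)"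
  shows "ext (single I M i m) (single J N j n) = b i j m n"
proof -
  have "ext (single I M i m) (single J N j n) = finsum P (\<lambda>_. b i j m n) {(i, j)}"
    unfolding bilinear_ext_def
  proof (rule P.add.finprod_mono_neutral_cong_left)
    \<comment> \<open>The pair \<open>(i, j)\<close> is missing from the product of supports only if
      \<open>m\<close> or \<open>n\<close> is zero, and then the bilinear value is zero as
      well.\<close>
    fix q assume "q \<in> {(i, j)} - supp I M (single I M i m) \<times> supp J N (single J N j n)"
    then have "m = \<zero>\<^bsub>M i\<^esub> \<or> n = \<zero>\<^bsub>N j\<^esub>"
      using i j by (auto simp: supp_def single_def)
    then show "b i j m n = \<zero>\<^bsub>P\<^esub>"
      using i j mod_hom_zero[OF M.module P.module_axioms linear_left]
        mod_hom_zero[OF N.module P.module_axioms linear_right] by auto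
  qed (use i j M.supp_single[of i m] N.supp_single[of j n] mod_hom_closed[OF linear_left] in
      \<open>auto simp: supp_def single_def split: if_splits\<close>)
  then show ?thesis
    using i j mod_hom_closed[OF linear_left] by (simp add: P.finsum_insert[of "{}"])
qed

end

section \<open>Transport of a linear category along a surjection on objects\<close>

context category_over
begin

lemma Comp_closed:
  "\<lbrakk>x \<in> Obj C; y \<in> Obj C; z \<in> Obj C; f \<in> carrier (Hom C y x); g \<in> carrier (Hom C z y)\<rbrakk> \<Longrightarrow>
    Comp C z y x g f \<in> carrier (Hom C z x)"
  using mod_hom_closed[OF Comp_linear_left] by blast

lemma Hom_add_closed:
  assumes "x \<in> Obj C" "y \<in> Obj C" "f \<in> carrier (Hom C y x)" "g \<in> carrier (Hom C y x)"
  shows "f \<oplus>\<^bsub>Hom C y x\<^esub> g \<in> carrier (Hom C y x)"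
proof -
  interpret module K "Hom C y x" by (rule Hom_module) fact+
  show ?thesis using assms by simp
qed

lemma Hom_smult_closed:
  assumes "x \<in> Obj C" "y \<in> Obj C" "a \<in> carrier K" "f \<in> carrier (Hom C y x)"
  shows "a \<odot>\<^bsub>Hom C y x\<^esub> f \<in> carrier (Hom C y x)"
proof -
  interpret module K "Hom C y x" by (rule Hom_module) fact+
  show ?thesis using assms by simp
qed

end

lemma linear_functor_id:
  assumes "category_over K C"
  shows "linear_functor K C C (\<lambda>x. x) (\<lambda>y x f. f)"
  by (intro linear_functor.intro linear_functor_axioms.intro assms) (auto intro: mod_hom_id)

lemma linear_functor_compose:
  assumes "linear_functor K C D Fo Fm" and "linear_functor K D E Ho Hm"
  shows "linear_functor K C E (\<lambda>x. Ho (Fo x)) (\<lambda>y x f. Hm (Fo y) (Fo x) (Fm y x f))"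
proof -
  interpret F: linear_functor K C D Fo Fm by fact
  interpret H: linear_functor K D E Ho Hm by fact
  show ?thesis
  proof (intro linear_functor.intro linear_functor_axioms.intro
      F.C.category_over_axioms H.D.category_over_axioms)
    fix x y assume "x \<in> Obj C" "y \<in> Obj C"
    then show "(\<lambda>f. Hm (Fo y) (Fo x) (Fm y x f)) \<in> mod_hom K (Hom C y x) (Hom E (Ho (Fo y)) (Ho (Fo x)))"
      by (intro mod_hom_compose[OF F.F_linear H.F_linear]) (auto intro: F.F_Obj)
  qed (auto simp: F.F_Obj H.F_Obj F.F_Comp F.F_Id H.F_Id
      intro!: H.F_Comp mod_hom_closed[OF F.F_linear])
qed

text \<open>Of \<open>D\<close> only the agreement of its fields with those of \<open>E\<close> is
  assumed. Since \<open>\<pi>\<close> may identify objects, \<open>\<psi>\<close> is indexed by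
  objects of \<open>E\<close>: different lifts of the same objects may identify a morphism set of
  \<open>D\<close> with different modules, and \<open>comp\<close> has to hold for all lifts. The
  condition \<open>zero\<close> is listed separately because the morphism sets of \<open>D\<close>
  are not yet known to be modules.\<close>

locale transported_category = category_over K E
  for K :: "('k, 'r) ring_scheme" and E :: "('k, 'o, 'm) lincat" +
  fixes D :: "('k, 'p, 'n) lincat" and \<pi> :: "'o \<Rightarrow> 'p" and \<psi> :: "'o \<Rightarrow> 'o \<Rightarrow> 'm \<Rightarrow> 'n"
  assumes Obj_image: "\<pi> ` Obj E = Obj D"
    and bij: "\<lbrakk>x \<in> Obj E; y \<in> Obj E\<rbrakk> \<Longrightarrow>
      bij_betw (\<psi> y x) (carrier (Hom E y x)) (carrier (Hom D (\<pi> y) (\<pi> x)))"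
    and linear: "\<lbrakk>x \<in> Obj E; y \<in> Obj E\<rbrakk> \<Longrightarrow>
      \<psi> y x \<in> mod_hom K (Hom E y x) (Hom D (\<pi> y) (\<pi> x))"
    and zero: "\<lbrakk>x \<in> Obj E; y \<in> Obj E\<rbrakk> \<Longrightarrow>
      \<psi> y x \<zero>\<^bsub>Hom E y x\<^esub> = \<zero>\<^bsub>Hom D (\<pi> y) (\<pi> x)\<^esub>"
    and comp: "\<lbrakk>x \<in> Obj E; y \<in> Obj E; z \<in> Obj E;
        f \<in> carrier (Hom E y x); g \<in> carrier (Hom E z y)\<rbrakk> \<Longrightarrow>
      \<psi> z x (Comp E z y x g f) = Comp D (\<pi> z) (\<pi> y) (\<pi> x) (\<psi> z y g) (\<psi> y x f)"
    and id: "x \<in> Obj E \<Longrightarrow> \<psi> x x (Id E x) = Id D (\<pi> x)"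
begin

lemma Obj_closed: "x \<in> Obj E \<Longrightarrow> \<pi> x \<in> Obj D"
  using Obj_image by blast

lemma Obj_cases: assumes "\<alpha> \<in> Obj D" obtains x where "x \<in> Obj E" "\<alpha> = \<pi> x"
  using assms Obj_image by blast

lemma carrier_Hom:
  "\<lbrakk>x \<in> Obj E; y \<in> Obj E\<rbrakk> \<Longrightarrow> carrier (Hom D (\<pi> y) (\<pi> x)) = \<psi> y x ` carrier (Hom E y x)"
  using bij by (simp add: bij_betw_def)

text \<open>Each axiom involves finitely many objects. Once these are lifted along
  \<open>\<pi>\<close>, every morphism between them lifts uniquely along \<open>\<psi>\<close>, so
  the axiom can be applied in \<open>E\<close> and its conclusion pushed down again.\<close>

lemma category_over_D: "category_over K D"
proof (intro category_over.intro category_over_axioms.intro K.cring_axioms)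
  fix \<alpha> \<beta> assume "\<alpha> \<in> Obj D" "\<beta> \<in> Obj D"
  then obtain x y where xy: "x \<in> Obj E" "y \<in> Obj E" and eq: "\<alpha> = \<pi> x" "\<beta> = \<pi> y"
    by (metis Obj_cases)
  show "module K (Hom D \<beta> \<alpha>)"
    unfolding eq
    by (rule module_transport[OF Hom_module bij])
      (use xy in \<open>auto simp: zero mod_hom_add[OF linear] mod_hom_smult[OF linear]\<close>)
  fix f assume "f \<in> carrier (Hom D \<beta> \<alpha>)"
  then obtain f' where f: "f = \<psi> y x f'" "f' \<in> carrier (Hom E y x)"
    using xy by (auto simp: eq carrier_Hom)
  show "Comp D \<beta> \<beta> \<alpha> (Id D \<beta>) f = f"
    using xy f by (simp add: eq id[symmetric] comp[symmetric] Id_closed Id_left)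
  show "Comp D \<beta> \<alpha> \<alpha> f (Id D \<alpha>) = f"
    using xy f by (simp add: eq id[symmetric] comp[symmetric] Id_closed Id_right)
next
  fix \<alpha> assume "\<alpha> \<in> Obj D"
  then obtain x where "x \<in> Obj E" "\<alpha> = \<pi> x"
    by (rule Obj_cases)
  then show "Id D \<alpha> \<in> carrier (Hom D \<alpha> \<alpha>)"
    by (auto simp: id[symmetric] carrier_Hom Id_closed)
next
  fix \<alpha> \<beta> \<gamma> assume "\<alpha> \<in> Obj D" "\<beta> \<in> Obj D" "\<gamma> \<in> Obj D"
  then obtain x y z where xyz: "x \<in> Obj E" "y \<in> Obj E" "z \<in> Obj E"
    and eq: "\<alpha> = \<pi> x" "\<beta> = \<pi> y" "\<gamma> = \<pi> z"
    by (metis Obj_cases)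
  note lin = mod_hom_add[OF linear, symmetric] mod_hom_smult[OF linear, symmetric]
    comp[symmetric] Hom_add_closed Hom_smult_closed Comp_closed
  show "(\<lambda>g. Comp D \<gamma> \<beta> \<alpha> g f) \<in> mod_hom K (Hom D \<gamma> \<beta>) (Hom D \<gamma> \<alpha>)"
    if f: "f \<in> carrier (Hom D \<beta> \<alpha>)" for f
  proof -
    obtain f' where f: "f = \<psi> y x f'" "f' \<in> carrier (Hom E y x)"
      using f xyz by (auto simp: eq carrier_Hom)
    show ?thesis
      using xyz f
      by (intro mod_homI) (auto simp: eq carrier_Hom lin mod_hom_add[OF Comp_linear_left]
          mod_hom_smult[OF Comp_linear_left])
  qed
  show "(\<lambda>f. Comp D \<gamma> \<beta> \<alpha> g f) \<in> mod_hom K (Hom D \<beta> \<alpha>) (Hom D \<gamma> \<alpha>)"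
    if g: "g \<in> carrier (Hom D \<gamma> \<beta>)" for g
  proof -
    obtain g' where g: "g = \<psi> z y g'" "g' \<in> carrier (Hom E z y)"
      using g xyz by (auto simp: eq carrier_Hom)
    show ?thesis
      using xyz g
      by (intro mod_homI) (auto simp: eq carrier_Hom lin mod_hom_add[OF Comp_linear_right]
          mod_hom_smult[OF Comp_linear_right])
  qed
  fix \<delta> f g h
  assume "\<delta> \<in> Obj D" and fgh: "f \<in> carrier (Hom D \<beta> \<alpha>)" "g \<in> carrier (Hom D \<gamma> \<beta>)"
    "h \<in> carrier (Hom D \<delta> \<gamma>)"
  then obtain w where w: "w \<in> Obj E" "\<delta> = \<pi> w"
    by (metis Obj_cases)
  show "Comp D \<delta> \<beta> \<alpha> (Comp D \<delta> \<gamma> \<beta> h g) f = Comp D \<delta> \<gamma> \<alpha> h (Comp D \<gamma> \<beta> \<alpha> g f)"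
    using xyz w fgh by (auto simp: eq carrier_Hom comp[symmetric] Comp_closed Comp_assoc)
qed

sublocale D: category_over K D
  by (rule category_over_D)

section \<open>The quasi-inverse and the two natural isomorphisms\<close>

lemma linear_functor_\<psi>: "linear_functor K E D \<pi> \<psi>"
  by (intro linear_functor.intro linear_functor_axioms.intro
      category_over_axioms D.category_over_axioms) (simp_all add: Obj_closed linear comp id)

text \<open>An arbitrary section of \<open>\<pi>\<close>; for the quotient category it picks a
  representative of each orbit.\<close>

definition \<rho> :: "'p \<Rightarrow> 'o" where "\<rho> = inv_into (Obj E) \<pi>"

text \<open>Indexed by arbitrary objects of \<open>E\<close> rather than by values of
  \<open>\<rho>\<close>, because comparing \<open>x\<close> with \<open>\<rho> (\<pi> x)\<close>
  needs lifts with mixed endpoints.\<close>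

definition \<chi> :: "'o \<Rightarrow> 'o \<Rightarrow> 'n \<Rightarrow> 'm"
  where "\<chi> y x = inv_into (carrier (Hom E y x)) (\<psi> y x)"

lemma \<rho>_Obj: "\<alpha> \<in> Obj D \<Longrightarrow> \<rho> \<alpha> \<in> Obj E"
  by (simp add: \<rho>_def Obj_image inv_into_into)

lemma \<pi>_\<rho>: "\<alpha> \<in> Obj D \<Longrightarrow> \<pi> (\<rho> \<alpha>) = \<alpha>"
  by (simp add: \<rho>_def Obj_image f_inv_into_f)

lemma \<chi>_\<psi>: "\<lbrakk>x \<in> Obj E; y \<in> Obj E; f \<in> carrier (Hom E y x)\<rbrakk> \<Longrightarrow> \<chi> y x (\<psi> y x f) = f"
  by (simp add: \<chi>_def bij_betw_imp_inj_on[OF bij] inv_into_f_f)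

lemma \<psi>_\<chi>:
  "\<lbrakk>x \<in> Obj E; y \<in> Obj E; p \<in> carrier (Hom D (\<pi> y) (\<pi> x))\<rbrakk> \<Longrightarrow> \<psi> y x (\<chi> y x p) = p"
  by (simp add: \<chi>_def carrier_Hom f_inv_into_f)

lemma \<chi>_linear:
  "\<lbrakk>x \<in> Obj E; y \<in> Obj E\<rbrakk> \<Longrightarrow> \<chi> y x \<in> mod_hom K (Hom D (\<pi> y) (\<pi> x)) (Hom E y x)"
  unfolding \<chi>_def by (intro inv_into_mod_hom Hom_module bij linear)

lemma \<chi>_comp:
  assumes "x \<in> Obj E" "y \<in> Obj E" "z \<in> Obj E"
    and "p \<in> carrier (Hom D (\<pi> y) (\<pi> x))" "q \<in> carrier (Hom D (\<pi> z) (\<pi> y))"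
  shows "\<chi> z x (Comp D (\<pi> z) (\<pi> y) (\<pi> x) q p) = Comp E z y x (\<chi> z y q) (\<chi> y x p)"
  using assms by (auto simp: carrier_Hom comp[symmetric] Comp_closed \<chi>_\<psi>)

lemma \<chi>_Id: "x \<in> Obj E \<Longrightarrow> \<chi> x x (Id D (\<pi> x)) = Id E x"
  by (simp add: id[symmetric] \<chi>_\<psi> Id_closed)

lemma linear_functor_\<chi>: "linear_functor K D E \<rho> (\<lambda>\<beta> \<alpha>. \<chi> (\<rho> \<beta>) (\<rho> \<alpha>))"
proof (intro linear_functor.intro linear_functor_axioms.intro
    category_over_axioms D.category_over_axioms)
  fix \<alpha> \<beta> assume "\<alpha> \<in> Obj D" "\<beta> \<in> Obj D"
  then show "\<chi> (\<rho> \<beta>) (\<rho> \<alpha>) \<in> mod_hom K (Hom D \<beta> \<alpha>) (Hom E (\<rho> \<beta>) (\<rho> \<alpha>))"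
    using \<chi>_linear[of "\<rho> \<alpha>" "\<rho> \<beta>"] by (simp add: \<rho>_Obj \<pi>_\<rho>)
next
  fix \<alpha> \<beta> \<gamma> p q
  assume "\<alpha> \<in> Obj D" "\<beta> \<in> Obj D" "\<gamma> \<in> Obj D"
    and "p \<in> carrier (Hom D \<beta> \<alpha>)" "q \<in> carrier (Hom D \<gamma> \<beta>)"
  then show "\<chi> (\<rho> \<gamma>) (\<rho> \<alpha>) (Comp D \<gamma> \<beta> \<alpha> q p) =
      Comp E (\<rho> \<gamma>) (\<rho> \<beta>) (\<rho> \<alpha>) (\<chi> (\<rho> \<gamma>) (\<rho> \<beta>) q) (\<chi> (\<rho> \<beta>) (\<rho> \<alpha>) p)"
    using \<chi>_comp[of "\<rho> \<alpha>" "\<rho> \<beta>" "\<rho> \<gamma>" p q] by (simp add: \<rho>_Obj \<pi>_\<rho>)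
next
  fix \<alpha> assume "\<alpha> \<in> Obj D"
  then show "\<chi> (\<rho> \<alpha>) (\<rho> \<alpha>) (Id D \<alpha>) = Id E (\<rho> \<alpha>)"
    using \<chi>_Id[of "\<rho> \<alpha>"] by (simp add: \<rho>_Obj \<pi>_\<rho>)
qed (rule \<rho>_Obj)

text \<open>On \<open>D\<close> the round trip fixes objects and morphisms, since
  \<open>\<rho>\<close> is a section of \<open>\<pi>\<close> and \<open>\<psi>\<close> undoes
  \<open>\<chi>\<close>. Hence identities serve as components.\<close>

lemma natural_isomorphism_D:
  "natural_isomorphism K D D (\<lambda>\<alpha>. \<alpha>) (\<lambda>\<beta> \<alpha> p. p)
    (\<lambda>\<alpha>. \<pi> (\<rho> \<alpha>)) (\<lambda>\<beta> \<alpha> p. \<psi> (\<rho> \<beta>) (\<rho> \<alpha>) (\<chi> (\<rho> \<beta>) (\<rho> \<alpha>) p)) (Id D)"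
proof (intro natural_isomorphism.intro natural_isomorphism_axioms.intro
    linear_functor_id D.category_over_axioms
    linear_functor_compose[OF linear_functor_\<chi> linear_functor_\<psi>])
  fix \<alpha> \<beta> p assume "\<alpha> \<in> Obj D" "\<beta> \<in> Obj D" "p \<in> carrier (Hom D \<beta> \<alpha>)"
  then show "Comp D (\<pi> (\<rho> \<beta>)) \<beta> \<alpha> (Id D \<beta>) p =
      Comp D (\<pi> (\<rho> \<beta>)) (\<pi> (\<rho> \<alpha>)) \<alpha> (\<psi> (\<rho> \<beta>) (\<rho> \<alpha>) (\<chi> (\<rho> \<beta>) (\<rho> \<alpha>) p)) (Id D \<alpha>)"
    by (simp add: \<rho>_Obj \<pi>_\<rho> \<psi>_\<chi> D.Id_left D.Id_right)
next
  fix \<alpha> assume "\<alpha> \<in> Obj D"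
  then show "Id D \<alpha> \<in> carrier (Hom D (\<pi> (\<rho> \<alpha>)) \<alpha>)"
    and "\<exists>\<theta>\<in>carrier (Hom D \<alpha> (\<pi> (\<rho> \<alpha>))).
      Comp D \<alpha> (\<pi> (\<rho> \<alpha>)) \<alpha> \<theta> (Id D \<alpha>) = Id D \<alpha> \<and>
      Comp D (\<pi> (\<rho> \<alpha>)) \<alpha> (\<pi> (\<rho> \<alpha>)) (Id D \<alpha>) \<theta> = Id D (\<pi> (\<rho> \<alpha>))"
    by (auto simp: \<pi>_\<rho> D.Id_closed D.Id_left intro!: bexI[of _ "Id D \<alpha>"])
qed

text \<open>The objects \<open>x\<close> and \<open>\<rho> (\<pi> x)\<close> have the same image, so
  the identity of \<open>\<pi> x\<close> lifts to a morphism between them in either direction. The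
  two lifts are mutually inverse because \<open>\<chi>\<close> respects composition and
  identities.\<close>

lemma natural_isomorphism_E:
  "natural_isomorphism K E E
    (\<lambda>x. \<rho> (\<pi> x)) (\<lambda>y x f. \<chi> (\<rho> (\<pi> y)) (\<rho> (\<pi> x)) (\<psi> y x f)) (\<lambda>x. x) (\<lambda>y x f. f)
    (\<lambda>x. \<chi> x (\<rho> (\<pi> x)) (Id D (\<pi> x)))"
proof (intro natural_isomorphism.intro natural_isomorphism_axioms.intro
    linear_functor_id category_over_axioms
    linear_functor_compose[OF linear_functor_\<psi> linear_functor_\<chi>])
  have obj: "\<rho> (\<pi> x) \<in> Obj E" "\<pi> (\<rho> (\<pi> x)) = \<pi> x" if "x \<in> Obj E" for x
    using that by (simp_all add: Obj_closed \<rho>_Obj \<pi>_\<rho>)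
  fix x assume x: "x \<in> Obj E"
  note Id = D.Id_closed[OF Obj_closed]
  show closed: "\<chi> x (\<rho> (\<pi> x)) (Id D (\<pi> x)) \<in> carrier (Hom E x (\<rho> (\<pi> x)))"
    using mod_hom_closed[OF \<chi>_linear[of "\<rho> (\<pi> x)" x], of "Id D (\<pi> x)"] x by (simp add: obj Id)
  show "\<exists>\<theta>\<in>carrier (Hom E (\<rho> (\<pi> x)) x).
      Comp E (\<rho> (\<pi> x)) x (\<rho> (\<pi> x)) \<theta> (\<chi> x (\<rho> (\<pi> x)) (Id D (\<pi> x))) = Id E (\<rho> (\<pi> x)) \<and>
      Comp E x (\<rho> (\<pi> x)) x (\<chi> x (\<rho> (\<pi> x)) (Id D (\<pi> x))) \<theta> = Id E x"
  proof (intro bexI[of _ "\<chi> (\<rho> (\<pi> x)) x (Id D (\<pi> x))"] conjI)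
    show "Comp E (\<rho> (\<pi> x)) x (\<rho> (\<pi> x)) (\<chi> (\<rho> (\<pi> x)) x (Id D (\<pi> x)))
        (\<chi> x (\<rho> (\<pi> x)) (Id D (\<pi> x))) = Id E (\<rho> (\<pi> x))"
      using \<chi>_comp[of "\<rho> (\<pi> x)" x "\<rho> (\<pi> x)" "Id D (\<pi> x)" "Id D (\<pi> x)"] \<chi>_Id[of "\<rho> (\<pi> x)"] x
      by (simp add: obj Id D.Id_left Obj_closed)
    show "Comp E x (\<rho> (\<pi> x)) x (\<chi> x (\<rho> (\<pi> x)) (Id D (\<pi> x)))
        (\<chi> (\<rho> (\<pi> x)) x (Id D (\<pi> x))) = Id E x"
      using \<chi>_comp[of x "\<rho> (\<pi> x)" x "Id D (\<pi> x)" "Id D (\<pi> x)"] \<chi>_Id[of x] x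
      by (simp add: obj Id D.Id_left Obj_closed)
    show "\<chi> (\<rho> (\<pi> x)) x (Id D (\<pi> x)) \<in> carrier (Hom E (\<rho> (\<pi> x)) x)"
      using mod_hom_closed[OF \<chi>_linear[of x "\<rho> (\<pi> x)"], of "Id D (\<pi> x)"] x by (simp add: obj Id)
  qed
  fix y f assume y: "y \<in> Obj E" and f: "f \<in> carrier (Hom E y x)"
  have \<psi>f: "\<psi> y x f \<in> carrier (Hom D (\<pi> y) (\<pi> x))"
    using x y f by (simp add: carrier_Hom)
  \<comment> \<open>Both sides of the naturality square are the lift of \<open>\<psi> y x f\<close>
    to a morphism from \<open>\<rho> (\<pi> x)\<close> to \<open>y\<close>.\<close>
  have "Comp E y (\<rho> (\<pi> y)) (\<rho> (\<pi> x)) (\<chi> y (\<rho> (\<pi> y)) (Id D (\<pi> y)))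
      (\<chi> (\<rho> (\<pi> y)) (\<rho> (\<pi> x)) (\<psi> y x f)) = \<chi> y (\<rho> (\<pi> x)) (\<psi> y x f)"
    using \<chi>_comp[of "\<rho> (\<pi> x)" "\<rho> (\<pi> y)" y "\<psi> y x f" "Id D (\<pi> y)"] x y \<psi>f
    by (simp add: obj Id D.Id_left Obj_closed)
  also have "\<dots> = Comp E y x (\<rho> (\<pi> x)) f (\<chi> x (\<rho> (\<pi> x)) (Id D (\<pi> x)))"
    using \<chi>_comp[of "\<rho> (\<pi> x)" x y "Id D (\<pi> x)" "\<psi> y x f"] x y f \<psi>f
    by (simp add: obj Id D.Id_right Obj_closed \<chi>_\<psi>)
  finally show "Comp E y (\<rho> (\<pi> y)) (\<rho> (\<pi> x)) (\<chi> y (\<rho> (\<pi> y)) (Id D (\<pi> y)))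
      (\<chi> (\<rho> (\<pi> y)) (\<rho> (\<pi> x)) (\<psi> y x f)) =
      Comp E y x (\<rho> (\<pi> x)) f (\<chi> x (\<rho> (\<pi> x)) (Id D (\<pi> x)))" .
qed

theorem equivalent: "equivalent_over K D E"
  unfolding equivalent_over_def
  using linear_functor_\<chi> linear_functor_\<psi> natural_isomorphism_D natural_isomorphism_E by blast

end

section \<open>Coinvariants as a quotient by a kernel\<close>

locale module_epi = M: module K M + N: module K N
  for K :: "('k, 'r) ring_scheme" and M :: "('k, 'm, 'c) module_scheme"
    and N :: "('k, 'n, 'd) module_scheme" +
  fixes \<Phi> :: "'m \<Rightarrow> 'n"
  assumes hom: "\<Phi> \<in> mod_hom K M N"
    and onto: "\<Phi> ` carrier M = carrier N"
begin

text \<open>As \<open>\<Phi>\<close> is onto, its fibres over \<open>N\<close> are exactly the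
  cosets of its kernel. So this map is the inverse of the isomorphism induced by
  \<open>\<Phi>\<close>, and this direction needs no choice of representatives.\<close>

definition fibre :: "'n \<Rightarrow> 'm set"
  where "fibre p = {u \<in> carrier M. \<Phi> u = p}"

abbreviation "ker \<equiv> fibre \<zero>\<^bsub>N\<^esub>"

lemmas hom_simps = mod_hom_add[OF hom] mod_hom_smult[OF hom] mod_hom_closed[OF hom]
  mod_hom_neg[OF M.module_axioms N.module_axioms hom]

lemma fibre_obtain:
  assumes "p \<in> carrier N" obtains u where "u \<in> carrier M" "\<Phi> u = p" "u \<in> fibre p"
proof -
  have "p \<in> \<Phi> ` carrier M"
    using assms by (simp add: onto)
  then show ?thesis
    by (auto simp: fibre_def intro: that)
qed

lemma coset_ker:
  assumes w: "w \<in> carrier M"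
  shows "ker +>\<^bsub>M\<^esub> w = fibre (\<Phi> w)"
proof
  show "ker +>\<^bsub>M\<^esub> w \<subseteq> fibre (\<Phi> w)"
    using w by (auto simp: fibre_def a_r_coset_def' hom_simps)
  show "fibre (\<Phi> w) \<subseteq> ker +>\<^bsub>M\<^esub> w"
  proof
    fix u assume u: "u \<in> fibre (\<Phi> w)"
    then have "u \<oplus>\<^bsub>M\<^esub> \<ominus>\<^bsub>M\<^esub> w \<in> ker" and "u = (u \<oplus>\<^bsub>M\<^esub> \<ominus>\<^bsub>M\<^esub> w) \<oplus>\<^bsub>M\<^esub> w"
      using w by (auto simp: fibre_def hom_simps N.M.r_neg M.M.l_neg M.M.a_assoc)
    then show "u \<in> ker +>\<^bsub>M\<^esub> w"
      by (auto simp: a_r_coset_def')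
  qed
qed

lemma bij_betw_fibre: "bij_betw fibre (carrier N) (carrier (quot_module M ker))"
proof -
  have "inj_on fibre (carrier N)"
    by (rule inj_onI) (metis (mono_tags, lifting) fibre_def fibre_obtain mem_Collect_eq)
  moreover have "carrier (quot_module M ker) = (\<lambda>w. fibre (\<Phi> w)) ` carrier M"
    by (auto simp: quot_module_def A_RCOSETS_def' coset_ker)
  ultimately show ?thesis
    by (simp add: bij_betw_def onto[symmetric] image_image)
qed

text \<open>For the inclusion that needs work, an element over the sum is split by subtracting one
  fixed \<open>v\<close> over \<open>q\<close>, which exists because \<open>\<Phi>\<close> is
  onto.\<close>

lemma fibre_add:
  assumes p: "p \<in> carrier N" and q: "q \<in> carrier N"
  shows "fibre (p \<oplus>\<^bsub>N\<^esub> q) = fibre p <+>\<^bsub>M\<^esub> fibre q"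
proof
  show "fibre p <+>\<^bsub>M\<^esub> fibre q \<subseteq> fibre (p \<oplus>\<^bsub>N\<^esub> q)"
    by (auto simp: fibre_def set_add_def' hom_simps)
  obtain v where v: "v \<in> carrier M" "\<Phi> v = q" "v \<in> fibre q"
    using q by (rule fibre_obtain)
  show "fibre (p \<oplus>\<^bsub>N\<^esub> q) \<subseteq> fibre p <+>\<^bsub>M\<^esub> fibre q"
  proof
    fix u assume u: "u \<in> fibre (p \<oplus>\<^bsub>N\<^esub> q)"
    then have "u \<oplus>\<^bsub>M\<^esub> \<ominus>\<^bsub>M\<^esub> v \<in> fibre p" and "u = (u \<oplus>\<^bsub>M\<^esub> \<ominus>\<^bsub>M\<^esub> v) \<oplus>\<^bsub>M\<^esub> v"
      using v p q by (auto simp: fibre_def hom_simps N.M.r_neg M.M.l_neg M.M.a_assoc N.M.a_assoc)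
    then show "u \<in> fibre p <+>\<^bsub>M\<^esub> fibre q"
      using v by (auto simp: set_add_def')
  qed
qed

lemma fibre_smult:
  assumes a: "a \<in> carrier K" and p: "p \<in> carrier N"
  shows "fibre (a \<odot>\<^bsub>N\<^esub> p) = (\<Union>u\<in>fibre p. ker +>\<^bsub>M\<^esub> (a \<odot>\<^bsub>M\<^esub> u))"
proof -
  have "ker +>\<^bsub>M\<^esub> (a \<odot>\<^bsub>M\<^esub> u) = fibre (a \<odot>\<^bsub>N\<^esub> p)" if "u \<in> fibre p" for u
  proof -
    have "u \<in> carrier M" "\<Phi> u = p"
      using that by (simp_all add: fibre_def)
    then show ?thesis
      using a by (simp add: coset_ker hom_simps)
  qed
  \<comment> \<open>All members of the union are the same coset; the fibre over \<open>p\<close>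
    must be nonempty for the union to equal it.\<close>
  then show ?thesis
    using fibre_obtain[OF p] by (metis (no_types, lifting) SUP_cong UN_constant emptyE)
qed

lemma fibre_mod_hom: "fibre \<in> mod_hom K N (quot_module M ker)"
  by (rule mod_homI)
    (use bij_betw_fibre in \<open>auto simp: bij_betw_def quot_module_def fibre_add fibre_smult\<close>)

end

lemma (in module) finsum_smult_left:
  assumes "finite A" and "a \<in> A \<rightarrow> carrier R" and w: "w \<in> carrier M"
  shows "finsum R a A \<odot>\<^bsub>M\<^esub> w = finsum M (\<lambda>s. a s \<odot>\<^bsub>M\<^esub> w) A"
  using assms(1,2) by (induction A rule: finite_induct) (use w in \<open>auto simp: smult_l_distr Pi_iff\<close>)

locale invariant_map =
  M: module K M + N: module K N + G: group G
  for K :: "('k, 'r) ring_scheme" and M :: "('k, 'm, 'c) module_scheme"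
    and N :: "('k, 'n, 'd) module_scheme" and G :: "('g, 'h) monoid_scheme" +
  fixes \<sigma> :: "'g \<Rightarrow> 'm \<Rightarrow> 'm" and \<Phi> :: "'m \<Rightarrow> 'n"
  assumes hom: "\<Phi> \<in> mod_hom K M N"
    and \<sigma>_closed: "\<lbrakk>s \<in> carrier G; u \<in> carrier M\<rbrakk> \<Longrightarrow> \<sigma> s u \<in> carrier M"
    and \<sigma>_one: "u \<in> carrier M \<Longrightarrow> \<sigma> \<one>\<^bsub>G\<^esub> u = u"
    and invariant: "\<lbrakk>s \<in> carrier G; u \<in> carrier M\<rbrakk> \<Longrightarrow> \<Phi> (\<sigma> s u) = \<Phi> u"
begin

lemma ga_smult_closed:
  assumes "a \<in> group_algebra K G" "u \<in> carrier M"
  shows "ga_smult K G M \<sigma> a u \<in> carrier M"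
  unfolding ga_smult_def
  by (rule M.finsum_closed) (use assms \<sigma>_closed in \<open>auto simp: group_algebra_def\<close>)

text \<open>Since \<open>\<Phi>\<close> does not distinguish \<open>\<sigma> s u\<close> from
  \<open>u\<close>, the value \<open>\<Phi> u\<close> factors out and the coefficients add up to the
  augmentation.\<close>

lemma \<Phi>_ga_smult:
  assumes a: "a \<in> group_algebra K G" and u: "u \<in> carrier M"
  shows "\<Phi> (ga_smult K G M \<sigma> a u) = augmentation K G a \<odot>\<^bsub>N\<^esub> \<Phi> u"
proof -
  let ?A = "{s \<in> carrier G. a s \<noteq> \<zero>\<^bsub>K\<^esub>}"
  have a': "a s \<in> carrier K" if "s \<in> carrier G" for s
    using that a by (auto simp: group_algebra_def)
  have "\<Phi> (ga_smult K G M \<sigma> a u) = finsum N (\<lambda>s. \<Phi> (a s \<odot>\<^bsub>M\<^esub> \<sigma> s u)) ?A"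
    unfolding ga_smult_def
    by (rule mod_hom_finsum[OF M.module_axioms N.module_axioms hom])
      (use a' u \<sigma>_closed in auto)
  also have "\<dots> = finsum N (\<lambda>s. a s \<odot>\<^bsub>N\<^esub> \<Phi> u) ?A"
    by (rule N.finsum_cong')
      (use a' u \<sigma>_closed invariant in \<open>auto simp: mod_hom_smult[OF hom] mod_hom_closed[OF hom]\<close>)
  also have "\<dots> = augmentation K G a \<odot>\<^bsub>N\<^esub> \<Phi> u"
    unfolding augmentation_def
    by (rule N.finsum_smult_left[symmetric])
      (use a a' u in \<open>auto simp: group_algebra_def mod_hom_closed[OF hom]\<close>)
  finally show ?thesis .
qed

lemma aug_submodule_subset: "aug_submodule K G M \<sigma> \<subseteq> {u \<in> carrier M. \<Phi> u = \<zero>\<^bsub>N\<^esub>}"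
proof
  fix u assume "u \<in> aug_submodule K G M \<sigma>"
  then show "u \<in> {u \<in> carrier M. \<Phi> u = \<zero>\<^bsub>N\<^esub>}"
    unfolding aug_submodule_def
  proof (induction rule: generate.induct)
    case one
    then show ?case by (simp add: mod_hom_zero[OF M.module_axioms N.module_axioms hom])
  next
    case (incl u)
    then show ?case by (auto simp: ga_smult_closed \<Phi>_ga_smult mod_hom_closed[OF hom])
  next
    case (inv u)
    then have "u \<in> carrier M" "\<Phi> u = \<zero>\<^bsub>N\<^esub>"
      by (auto simp: ga_smult_closed \<Phi>_ga_smult mod_hom_closed[OF hom])
    then show ?case
      unfolding a_inv_def[symmetric]
      by (simp add: mod_hom_neg[OF M.module_axioms N.module_axioms hom])
  next
    case (eng u v)
    then show ?case by (simp add: mod_hom_add[OF hom])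
  qed
qed

lemma aug_submodule_zero: "\<zero>\<^bsub>M\<^esub> \<in> aug_submodule K G M \<sigma>"
  using generate.one[of "add_monoid M"] by (simp add: aug_submodule_def)

lemma aug_submodule_add:
  "\<lbrakk>u \<in> aug_submodule K G M \<sigma>; v \<in> aug_submodule K G M \<sigma>\<rbrakk> \<Longrightarrow>
    u \<oplus>\<^bsub>M\<^esub> v \<in> aug_submodule K G M \<sigma>"
  using generate.eng[of u "add_monoid M"] by (simp add: aug_submodule_def)

text \<open>The element is \<open>(1 - s) u\<close>, and \<open>1 - s\<close> has augmentation
  zero.\<close>

lemma aug_submodule_diff:
  assumes s: "s \<in> carrier G" and u: "u \<in> carrier M"
  shows "u \<oplus>\<^bsub>M\<^esub> \<ominus>\<^bsub>M\<^esub> \<sigma> s u \<in> aug_submodule K G M \<sigma>"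
\<comment> \<open>For neutral \<open>s\<close> the two coefficients would fall on the same group
  element, so this case is treated separately.\<close>
proof (cases "s = \<one>\<^bsub>G\<^esub>")
  case True
  then show ?thesis
    using u by (simp add: \<sigma>_one M.M.r_neg aug_submodule_zero)
next
  case False
  define a where "a = (\<lambda>r\<in>carrier G. if r = \<one>\<^bsub>G\<^esub> then \<one>\<^bsub>K\<^esub>
    else if r = s then \<ominus>\<^bsub>K\<^esub> \<one>\<^bsub>K\<^esub> else \<zero>\<^bsub>K\<^esub>)"
  \<comment> \<open>Only an inclusion: \<open>K\<close> may be the zero ring, over which the support
    of \<open>a\<close> is empty.\<close>
  have sub: "{r \<in> carrier G. a r \<noteq> \<zero>\<^bsub>K\<^esub>} \<subseteq> {\<one>\<^bsub>G\<^esub>, s}"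
    by (auto simp: a_def)
  have a: "a \<in> group_algebra K G"
    using finite_subset[OF sub] by (auto simp: group_algebra_def a_def)
  have "augmentation K G a = finsum K a {\<one>\<^bsub>G\<^esub>, s}"
    unfolding augmentation_def
    by (rule M.R.add.finprod_mono_neutral_cong_left) (use sub s in \<open>auto simp: a_def\<close>)
  also have "\<dots> = \<zero>\<^bsub>K\<^esub>"
    using s False by (simp add: a_def M.R.r_neg)
  finally have 0: "augmentation K G a = \<zero>\<^bsub>K\<^esub>" .
  have "ga_smult K G M \<sigma> a u = finsum M (\<lambda>r. a r \<odot>\<^bsub>M\<^esub> \<sigma> r u) {\<one>\<^bsub>G\<^esub>, s}"
    unfolding ga_smult_def
    by (rule M.M.add.finprod_mono_neutral_cong_left) (use sub s u \<sigma>_closed in \<open>auto simp: a_def\<close>)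
  also have "\<dots> = u \<oplus>\<^bsub>M\<^esub> \<ominus>\<^bsub>M\<^esub> \<sigma> s u"
    using s u False \<sigma>_closed by (simp add: a_def \<sigma>_one M.smult_l_minus)
  finally show ?thesis
    unfolding aug_submodule_def using a 0 u by (intro generate.incl CollectI exI[of _ a] exI[of _ u]) simp
qed

lemma aug_submodule_eq:
  assumes "\<And>u. \<lbrakk>u \<in> carrier M; \<Phi> u = \<zero>\<^bsub>N\<^esub>\<rbrakk> \<Longrightarrow> u \<in> aug_submodule K G M \<sigma>"
  shows "aug_submodule K G M \<sigma> = {u \<in> carrier M. \<Phi> u = \<zero>\<^bsub>N\<^esub>}"
  using assms aug_submodule_subset by blast

end

section \<open>The skew category\<close>

context G_category
begin

lemma act_closed: "\<lbrakk>s \<in> carrier G; x \<in> Obj C\<rbrakk> \<Longrightarrow> act s x \<in> Obj C"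
  using element_image by blast

lemma act_one: "x \<in> Obj C \<Longrightarrow> act \<one>\<^bsub>G\<^esub> x = x"
  using id_eq_one by (metis restrict_apply')

lemma act_mult:
  "\<lbrakk>s \<in> carrier G; t \<in> carrier G; x \<in> Obj C\<rbrakk> \<Longrightarrow> act (t \<otimes>\<^bsub>G\<^esub> s) x = act t (act s x)"
  by (simp add: composition_rule)

lemma act_inv_eq_iff:
  "\<lbrakk>s \<in> carrier G; x \<in> Obj C; y \<in> Obj C\<rbrakk> \<Longrightarrow> act (inv\<^bsub>G\<^esub> s) x = y \<longleftrightarrow> x = act s y"
  using orbit_sym_aux[of s y x] orbit_sym_aux[of "inv\<^bsub>G\<^esub> s" x y] by auto

lemma actM_closed:
  "\<lbrakk>s \<in> carrier G; x \<in> Obj C; y \<in> Obj C; f \<in> carrier (Hom C y x)\<rbrakk> \<Longrightarrow>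
    actM s y x f \<in> carrier (Hom C (act s y) (act s x))"
  using mod_hom_closed[OF actM_linear] by blast

text \<open>Invertibility of \<open>s\<close> is the reason. Let \<open>g\<close> be the translate,
  by the inverse of \<open>s\<close>, of the identity at \<open>act s x\<close>. Then
  \<open>s\<close> sends \<open>g\<close> to that identity, and applying \<open>s\<close> to the
  composite of \<open>Id C x\<close> with \<open>g\<close> can be evaluated in two ways: as the
  image of \<open>g\<close> and as the image of \<open>Id C x\<close>.\<close>

lemma actM_Id:
  assumes s: "s \<in> carrier G" and x: "x \<in> Obj C"
  shows "actM s x x (Id C x) = Id C (act s x)"
proof -
  let ?y = "act s x"
  have y: "?y \<in> Obj C" "act (inv\<^bsub>G\<^esub> s) ?y = x"
    using s x by (simp_all add: act_closed act_inv_eq_iff)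
  define g where "g = actM (inv\<^bsub>G\<^esub> s) ?y ?y (Id C ?y)"
  have g: "g \<in> carrier (Hom C x x)"
    using actM_closed[of "inv\<^bsub>G\<^esub> s" ?y ?y "Id C ?y"] s x y by (simp add: g_def Id_closed)
  have sg: "actM s x x g = Id C ?y"
    using actM_mult[of "inv\<^bsub>G\<^esub> s" s ?y ?y "Id C ?y"] s x y
    by (simp add: g_def Id_closed actM_one)
  have "actM s x x (Comp C x x x (Id C x) g) = actM s x x (Id C x)"
    using s x y g by (simp add: actM_Comp Id_closed sg Id_right actM_closed)
  then show ?thesis
    using x g by (simp add: Id_left sg)
qed

lemma skew_family:
  "\<lbrakk>x \<in> Obj C; y \<in> Obj C\<rbrakk> \<Longrightarrow> module_family K (carrier G) (\<lambda>s. Hom C y (act s x))"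
  by (intro module_family.intro module_family_axioms.intro K.cring_axioms)
    (simp add: Hom_module act_closed)

lemma skew_homs_module: "\<lbrakk>x \<in> Obj C; y \<in> Obj C\<rbrakk> \<Longrightarrow> module K (skew_homs G C act y x)"
  unfolding skew_homs_def by (rule module_family.direct_sum_module[OF skew_family])

abbreviation skew_single :: "'o \<Rightarrow> 'o \<Rightarrow> 'g \<Rightarrow> 'm \<Rightarrow> 'g \<Rightarrow> 'm"
  where "skew_single y x \<equiv> single (carrier G) (\<lambda>s. Hom C y (act s x))"

lemma skew_single_mod_hom:
  "\<lbrakk>x \<in> Obj C; y \<in> Obj C; s \<in> carrier G; x' = act s x\<rbrakk> \<Longrightarrow>
    skew_single y x s \<in> mod_hom K (Hom C y x') (skew_homs G C act y x)"
  unfolding skew_homs_def using module_family.single_mod_hom[OF skew_family] by blast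

lemma skew_single_closed:
  "\<lbrakk>x \<in> Obj C; y \<in> Obj C; s \<in> carrier G; f \<in> carrier (Hom C y (act s x))\<rbrakk> \<Longrightarrow>
    skew_single y x s f \<in> carrier (skew_homs G C act y x)"
  using mod_hom_closed[OF skew_single_mod_hom] by blast

text \<open>For fixed indices the rule consists of translation by \<open>t\<close>, composition in
  \<open>C\<close> and inclusion of the summand at \<open>ts\<close>, all of which are
  linear.\<close>

lemma skew_bilinear:
  assumes x: "x \<in> Obj C" and y: "y \<in> Obj C" and z: "z \<in> Obj C"
  shows "bilinear_family K (carrier G) (\<lambda>t. Hom C z (act t y)) (carrier G) (\<lambda>s. Hom C y (act s x))
    (skew_homs G C act z x)
    (\<lambda>t s g f. skew_single z x (t \<otimes>\<^bsub>G\<^esub> s)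
      (Comp C z (act t y) (act (t \<otimes>\<^bsub>G\<^esub> s) x) g (actM t y (act s x) f)))"
proof (intro bilinear_family.intro bilinear_family_axioms.intro skew_family skew_homs_module assms)
  fix t s assume t: "t \<in> carrier G" and s: "s \<in> carrier G"
  note obj = assms t s act_closed act_mult
  have single: "skew_single z x (t \<otimes>\<^bsub>G\<^esub> s) \<in>
      mod_hom K (Hom C z (act (t \<otimes>\<^bsub>G\<^esub> s) x)) (skew_homs G C act z x)"
    using obj by (simp add: skew_single_mod_hom)
  show "(\<lambda>g. skew_single z x (t \<otimes>\<^bsub>G\<^esub> s)
      (Comp C z (act t y) (act (t \<otimes>\<^bsub>G\<^esub> s) x) g (actM t y (act s x) f)))
      \<in> mod_hom K (Hom C z (act t y)) (skew_homs G C act z x)"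
    if f: "f \<in> carrier (Hom C y (act s x))" for f
    by (rule mod_hom_compose[OF Comp_linear_left single])
      (use obj actM_closed[OF t _ y f] in simp_all)
  show "(\<lambda>f. skew_single z x (t \<otimes>\<^bsub>G\<^esub> s)
      (Comp C z (act t y) (act (t \<otimes>\<^bsub>G\<^esub> s) x) g (actM t y (act s x) f)))
      \<in> mod_hom K (Hom C y (act s x)) (skew_homs G C act z x)"
    if g: "g \<in> carrier (Hom C z (act t y))" for g
  proof -
    have "actM t y (act s x) \<in>
        mod_hom K (Hom C y (act s x)) (Hom C (act t y) (act (t \<otimes>\<^bsub>G\<^esub> s) x))"
      using actM_linear[of t "act s x" y] obj by simp
    then show ?thesis
      by (rule mod_hom_compose[OF mod_hom_compose[OF _ Comp_linear_right] single])
        (use obj g in simp_all)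
  qed
qed

lemma skew_comp_eq_bilinear_ext:
  "skew_comp G C act actM z y x =
    bilinear_ext (carrier G) (\<lambda>t. Hom C z (act t y)) (carrier G) (\<lambda>s. Hom C y (act s x))
    (skew_homs G C act z x)
    (\<lambda>t s g f. skew_single z x (t \<otimes>\<^bsub>G\<^esub> s)
      (Comp C z (act t y) (act (t \<otimes>\<^bsub>G\<^esub> s) x) g (actM t y (act s x) f)))"
  by (intro ext) (simp add: skew_comp_def bilinear_ext_def)

lemma skew_comp_linear_left:
  "\<lbrakk>x \<in> Obj C; y \<in> Obj C; z \<in> Obj C; u \<in> carrier (skew_homs G C act y x)\<rbrakk> \<Longrightarrow>
    (\<lambda>v. skew_comp G C act actM z y x v u) \<in>
      mod_hom K (skew_homs G C act z y) (skew_homs G C act z x)"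
  using bilinear_family.ext_linear_left[OF skew_bilinear]
  unfolding skew_comp_eq_bilinear_ext skew_homs_def[of _ _ _ z y] skew_homs_def[of _ _ _ y x] by blast

lemma skew_comp_linear_right:
  "\<lbrakk>x \<in> Obj C; y \<in> Obj C; z \<in> Obj C; v \<in> carrier (skew_homs G C act z y)\<rbrakk> \<Longrightarrow>
    (\<lambda>u. skew_comp G C act actM z y x v u) \<in>
      mod_hom K (skew_homs G C act y x) (skew_homs G C act z x)"
  using bilinear_family.ext_linear_right[OF skew_bilinear]
  unfolding skew_comp_eq_bilinear_ext skew_homs_def[of _ _ _ z y] skew_homs_def[of _ _ _ y x] by blast

lemma skew_comp_closed:
  "\<lbrakk>x \<in> Obj C; y \<in> Obj C; z \<in> Obj C; v \<in> carrier (skew_homs G C act z y);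
    u \<in> carrier (skew_homs G C act y x)\<rbrakk> \<Longrightarrow>
    skew_comp G C act actM z y x v u \<in> carrier (skew_homs G C act z x)"
  using mod_hom_closed[OF skew_comp_linear_left] by blast

lemma skew_comp_single:
  "\<lbrakk>x \<in> Obj C; y \<in> Obj C; z \<in> Obj C; t \<in> carrier G; g \<in> carrier (Hom C z (act t y));
    s \<in> carrier G; f \<in> carrier (Hom C y (act s x))\<rbrakk> \<Longrightarrow>
    skew_comp G C act actM z y x (skew_single z y t g) (skew_single y x s f) =
    skew_single z x (t \<otimes>\<^bsub>G\<^esub> s) (Comp C z (act t y) (act t (act s x)) g (actM t y (act s x) f))"
  unfolding skew_comp_eq_bilinear_ext
  by (subst bilinear_family.ext_single[OF skew_bilinear]) (auto simp: act_mult)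

lemma skew_mod_hom_eqI:
  assumes "x \<in> Obj C" "y \<in> Obj C" and "module K N"
    and "F \<in> mod_hom K (skew_homs G C act y x) N" "F' \<in> mod_hom K (skew_homs G C act y x) N"
    and "\<And>s f. \<lbrakk>s \<in> carrier G; f \<in> carrier (Hom C y (act s x))\<rbrakk> \<Longrightarrow>
      F (skew_single y x s f) = F' (skew_single y x s f)"
    and "u \<in> carrier (skew_homs G C act y x)"
  shows "F u = F' u"
  using module_family.mod_hom_eqI[OF skew_family[OF assms(1,2)] assms(3)] assms(4-7)
  unfolding skew_homs_def by blast

text \<open>By trilinearity it suffices to take homogeneous \<open>c\<close>, \<open>b\<close>,
  \<open>a\<close> at the indices \<open>r\<close>, \<open>t\<close>, \<open>s\<close>. There both
  sides are the composite of \<open>c\<close>, \<open>rb\<close> and \<open>rta\<close> in the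
  component at \<open>rts\<close>, because \<open>r\<close> respects composition and the action is
  multiplicative.\<close>

lemma skew_comp_assoc:
  assumes obj: "x \<in> Obj C" "y \<in> Obj C" "z \<in> Obj C" "w \<in> Obj C"
    and u: "u \<in> carrier (skew_homs G C act y x)" and v: "v \<in> carrier (skew_homs G C act z y)"
    and h: "h \<in> carrier (skew_homs G C act w z)"
  shows "skew_comp G C act actM w y x (skew_comp G C act actM w z y h v) u =
    skew_comp G C act actM w z x h (skew_comp G C act actM z y x v u)"
proof -
  let ?S = "skew_comp G C act actM"
  note lin = skew_comp_linear_left skew_comp_linear_right
  note closed = skew_comp_closed skew_single_closed
  have 1: "?S w y x (?S w z y (skew_single w z r c) (skew_single z y t b)) (skew_single y x s a) =
      ?S w z x (skew_single w z r c) (?S z y x (skew_single z y t b) (skew_single y x s a))"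
    if "r \<in> carrier G" "c \<in> carrier (Hom C w (act r z))" "t \<in> carrier G"
      "b \<in> carrier (Hom C z (act t y))" "s \<in> carrier G" "a \<in> carrier (Hom C y (act s x))"
    for r c t b s a
  proof -
    have b: "actM r z (act t y) b \<in> carrier (Hom C (act r z) (act r (act t y)))"
      using that obj by (simp add: actM_closed act_closed)
    have a: "actM t y (act s x) a \<in> carrier (Hom C (act t y) (act t (act s x)))"
      using that obj by (simp add: actM_closed act_closed)
    have ra: "actM r (act t y) (act t (act s x)) (actM t y (act s x) a) \<in>
        carrier (Hom C (act r (act t y)) (act r (act t (act s x))))"
      using that obj a by (simp add: actM_closed act_closed)
    have cb: "Comp C w (act r z) (act r (act t y)) c (actM r z (act t y) b) \<in>
        carrier (Hom C w (act (r \<otimes>\<^bsub>G\<^esub> t) y))"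
      using that obj b by (simp add: act_mult Comp_closed act_closed)
    have ba: "Comp C z (act t y) (act t (act s x)) b (actM t y (act s x) a) \<in>
        carrier (Hom C z (act (t \<otimes>\<^bsub>G\<^esub> s) x))"
      using that obj a by (simp add: act_mult Comp_closed act_closed)
    show ?thesis
      using that obj a b ra cb ba
      by (simp add: skew_comp_single act_mult actM_mult actM_Comp Comp_assoc act_closed m_assoc)
  qed
  \<comment> \<open>Homogeneity is dropped for \<open>u\<close>, then \<open>v\<close>, then
    \<open>h\<close>, each time by comparing two maps that are linear in that argument.\<close>
  have 2: "?S w y x (?S w z y (skew_single w z r c) (skew_single z y t b)) u =
      ?S w z x (skew_single w z r c) (?S z y x (skew_single z y t b) u)"
    if "r \<in> carrier G" "c \<in> carrier (Hom C w (act r z))" "t \<in> carrier G"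
      "b \<in> carrier (Hom C z (act t y))" for r c t b
    by (rule skew_mod_hom_eqI[OF obj(1,2) skew_homs_module _ mod_hom_compose[OF lin(2) lin(2)] 1 u])
      (use that obj in \<open>auto intro!: lin closed\<close>)
  have 3: "?S w y x (?S w z y (skew_single w z r c) v) u = ?S w z x (skew_single w z r c) (?S z y x v u)"
    if "r \<in> carrier G" "c \<in> carrier (Hom C w (act r z))" for r c
    by (rule skew_mod_hom_eqI[OF obj(2,3) skew_homs_module mod_hom_compose[OF lin(2) lin(1)]
          mod_hom_compose[OF lin(1) lin(2)] 2 v])
      (use that obj u in \<open>auto intro!: closed\<close>)
  show ?thesis
    by (rule skew_mod_hom_eqI[OF obj(3,4) skew_homs_module mod_hom_compose[OF lin(1) lin(1)]
          lin(1) 3 h])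
      (use obj u v in \<open>auto intro!: closed\<close>)
qed

lemma skew_category_simps:
  "Obj (skew_category G C act actM) = Obj C"
  "Hom (skew_category G C act actM) = skew_homs G C act"
  "Comp (skew_category G C act actM) = skew_comp G C act actM"
  "Id (skew_category G C act actM) x = skew_single x x \<one>\<^bsub>G\<^esub> (Id C x)"
  by (simp_all add: skew_category_def)

text \<open>The identity sits in the component at the neutral element. As a left factor it
  translates the other factor trivially, by \<open>actM_one\<close>; as a right factor it is itself
  translated by the index of the other factor, which is where \<open>actM_Id\<close> enters.\<close>

lemma skew_category_over: "category_over K (skew_category G C act actM)"
proof (intro category_over.intro category_over_axioms.intro K.cring_axioms, unfold skew_category_simps)
  have Id: "Id C x \<in> carrier (Hom C x (act \<one>\<^bsub>G\<^esub> x))" if "x \<in> Obj C" for x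
    using that by (simp add: act_one Id_closed)
  fix x assume x: "x \<in> Obj C"
  show "skew_single x x \<one>\<^bsub>G\<^esub> (Id C x) \<in> carrier (skew_homs G C act x x)"
    using x Id by (simp add: skew_single_closed)
  fix y u assume y: "y \<in> Obj C" and u: "u \<in> carrier (skew_homs G C act y x)"
  show "skew_comp G C act actM y y x (skew_single y y \<one>\<^bsub>G\<^esub> (Id C y)) u = u"
    by (rule skew_mod_hom_eqI[OF x y skew_homs_module[OF x y] skew_comp_linear_right mod_hom_id _ u])
      (use x y Id in \<open>auto simp: skew_comp_single skew_single_closed act_one act_closed actM_one Id_left\<close>)
  show "skew_comp G C act actM y x x u (skew_single x x \<one>\<^bsub>G\<^esub> (Id C x)) = u"
    by (rule skew_mod_hom_eqI[OF x y skew_homs_module[OF x y] skew_comp_linear_left mod_hom_id _ u])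
      (use x y Id in \<open>auto simp: skew_comp_single skew_single_closed act_one act_closed actM_Id Id_right\<close>)
qed (auto intro: skew_homs_module skew_comp_linear_left skew_comp_linear_right skew_comp_assoc)

end

section \<open>From the quotient category to the skew category\<close>

context free_G_category
begin

section \<open>Orbits and transporters of a free action\<close>

abbreviation orb where "orb x \<equiv> orbit G act x"

abbreviation pair_hom where "pair_hom \<equiv> \<lambda>(y, x). Hom C y x"

lemma orb_Obj: "\<lbrakk>x \<in> Obj C; x' \<in> orb x\<rbrakk> \<Longrightarrow> x' \<in> Obj C"
  by (auto simp: orbit_def act_closed)

lemma orb_act: "\<lbrakk>x \<in> Obj C; x' \<in> orb x; s \<in> carrier G\<rbrakk> \<Longrightarrow> act s x' \<in> orb x"
  by (auto simp: orbit_def act_mult[symmetric])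

lemma orb_obtain:
  assumes "x \<in> Obj C" "x' \<in> orb x" "x'' \<in> orb x"
  obtains s where "s \<in> carrier G" "act s x' = x''"
proof -
  obtain a b where ab: "a \<in> carrier G" "x' = act a x" "b \<in> carrier G" "x'' = act b x"
    using assms by (auto simp: orbit_def)
  then have "act (b \<otimes>\<^bsub>G\<^esub> inv\<^bsub>G\<^esub> a) x' = x''"
    using assms(1) by (simp add: act_mult[symmetric] m_assoc)
  then show ?thesis
    using ab by (intro that[of "b \<otimes>\<^bsub>G\<^esub> inv\<^bsub>G\<^esub> a"]) auto
qed

text \<open>The product of the inverse of \<open>t\<close> with \<open>s\<close> fixes
  \<open>x\<close>, so freeness applies. Later arguments use freeness through this cancellation,
  directly or by way of \<open>transporter_eq\<close>.\<close>

lemma act_inj: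
  assumes "s \<in> carrier G" "t \<in> carrier G" "x \<in> Obj C" "act s x = act t x"
  shows "s = t"
proof -
  have "act (inv\<^bsub>G\<^esub> t \<otimes>\<^bsub>G\<^esub> s) x = x"
    using assms by (simp add: act_mult act_inv_eq_iff act_closed)
  then have "inv\<^bsub>G\<^esub> t \<otimes>\<^bsub>G\<^esub> s = \<one>\<^bsub>G\<^esub>"
    using assms free by simp
  then show ?thesis
    using assms by (metis inv_closed inv_inv inv_equality)
qed

lemma transporter_eq:
  "\<lbrakk>s \<in> carrier G; x \<in> Obj C; act s x = x'\<rbrakk> \<Longrightarrow> transporter G act x x' = s"
  unfolding transporter_def by (rule the_equality) (auto intro: act_inj)

section \<open>Direct sums over two orbits and their map to skew morphisms\<close>

lemma pair_family:
  "\<lbrakk>x \<in> Obj C; y \<in> Obj C\<rbrakk> \<Longrightarrow> module_family K (orb y \<times> orb x) pair_hom"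
  by (intro module_family.intro module_family_axioms.intro K.cring_axioms)
    (auto intro: Hom_module orb_Obj)

lemma orbit_homs_module: "\<lbrakk>x \<in> Obj C; y \<in> Obj C\<rbrakk> \<Longrightarrow> module K (orbit_homs C (orb y) (orb x))"
  unfolding orbit_homs_def by (rule module_family.direct_sum_module[OF pair_family])

abbreviation pair_single where "pair_single y x \<equiv> single (orb y \<times> orb x) pair_hom"

lemma pair_single_mod_hom:
  "\<lbrakk>x \<in> Obj C; y \<in> Obj C; y' \<in> orb y; x' \<in> orb x\<rbrakk> \<Longrightarrow>
    pair_single y x (y', x') \<in> mod_hom K (Hom C y' x') (orbit_homs C (orb y) (orb x))"
  unfolding orbit_homs_def
  using module_family.single_mod_hom[OF pair_family, of x y "(y', x')"] by auto

lemma pair_single_closed: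
  "\<lbrakk>x \<in> Obj C; y \<in> Obj C; y' \<in> orb y; x' \<in> orb x; m \<in> carrier (Hom C y' x')\<rbrakk> \<Longrightarrow>
    pair_single y x (y', x') m \<in> carrier (orbit_homs C (orb y) (orb x))"
  using mod_hom_closed[OF pair_single_mod_hom] by blast

lemma pair_mod_hom_eqI:
  assumes "x \<in> Obj C" "y \<in> Obj C" and "module K N"
    and "F \<in> mod_hom K (orbit_homs C (orb y) (orb x)) N"
    and "F' \<in> mod_hom K (orbit_homs C (orb y) (orb x)) N"
    and "\<And>y' x' f. \<lbrakk>y' \<in> orb y; x' \<in> orb x; f \<in> carrier (Hom C y' x')\<rbrakk> \<Longrightarrow>
      F (pair_single y x (y', x') f) = F' (pair_single y x (y', x') f)"
    and "u \<in> carrier (orbit_homs C (orb y) (orb x))"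
  shows "F u = F' u"
  by (rule module_family.mod_hom_eqI[OF pair_family[OF assms(1,2)] assms(3)])
    (use assms(4-7) in \<open>auto simp: orbit_homs_def\<close>)

text \<open>The summand of morphisms from \<open>x'\<close> to \<open>y'\<close> is moved by the unique \<open>r\<close> with \<open>ry' = y\<close>;
  then \<open>rx' = tx\<close> for a unique \<open>t\<close>, which is the index in the skew category.\<close>

definition collapse_at where "collapse_at y x = (\<lambda>(y', x') m.
    let r = transporter G act y' y in
      skew_single y x (transporter G act x (act r x')) (actM r y' x' m))"

definition collapse where "collapse y x =
    linear_ext (orb y \<times> orb x) pair_hom (skew_homs G C act y x) (collapse_at y x)"

text \<open>Freeness allows any group elements with the required effect to replace the definite
  descriptions in \<open>collapse_at\<close>.\<close>

lemma collapse_at_eq: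
  assumes "x \<in> Obj C" "y' \<in> Obj C" "r \<in> carrier G" "act r y' = y" "t \<in> carrier G" "act t x = act r x'"
  shows "collapse_at y x (y', x') m = skew_single y x t (actM r y' x' m)"
  using assms by (simp add: collapse_at_def transporter_eq[of r] transporter_eq[of t])

text \<open>Transitivity on the orbit of \<open>y\<close> supplies \<open>r\<close>; translation by
  \<open>r\<close> keeps \<open>x'\<close> in the orbit of \<open>x\<close>, which supplies
  \<open>t\<close>.\<close>

lemma collapse_obtain:
  assumes "x \<in> Obj C" "y \<in> Obj C" "y' \<in> orb y" "x' \<in> orb x"
  obtains r t where "r \<in> carrier G" "act r y' = y" "t \<in> carrier G" "act t x = act r x'"
proof -
  obtain r where r: "r \<in> carrier G" "act r y' = y"
    using assms orb_obtain orbit_refl by metis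
  moreover obtain t where "t \<in> carrier G" "act t x = act r x'"
    using assms r orb_obtain orbit_refl orb_act by metis
  ultimately show ?thesis by (rule that)
qed

lemma collapse_at_mod_hom:
  assumes obj: "x \<in> Obj C" "y \<in> Obj C" "y' \<in> orb y" "x' \<in> orb x"
  shows "collapse_at y x (y', x') \<in> mod_hom K (Hom C y' x') (skew_homs G C act y x)"
proof -
  obtain r t where rt: "r \<in> carrier G" "act r y' = y" "t \<in> carrier G" "act t x = act r x'"
    using obj by (rule collapse_obtain)
  have obj': "y' \<in> Obj C" "x' \<in> Obj C"
    using obj orb_Obj by auto
  have "collapse_at y x (y', x') = (\<lambda>m. skew_single y x t (actM r y' x' m))"
    using obj obj' rt by (intro ext collapse_at_eq) auto
  moreover have "\<dots> \<in> mod_hom K (Hom C y' x') (skew_homs G C act y x)"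
    using mod_hom_compose[OF actM_linear[OF rt(1) obj'(2,1)] skew_single_mod_hom[of x _ t]] obj rt
    by simp
  ultimately show ?thesis by simp
qed

lemma collapse_mod_hom:
  assumes "x \<in> Obj C" "y \<in> Obj C"
  shows "collapse y x \<in> mod_hom K (orbit_homs C (orb y) (orb x)) (skew_homs G C act y x)"
  unfolding collapse_def orbit_homs_def
  by (rule module_family.linear_ext_mod_hom[OF pair_family[OF assms] skew_homs_module[OF assms]])
    (use assms in \<open>auto intro: collapse_at_mod_hom\<close>)

lemmas collapse_closed = mod_hom_closed[OF collapse_mod_hom]

lemma collapse_single:
  assumes obj: "x \<in> Obj C" "y \<in> Obj C" "y' \<in> orb y" "x' \<in> orb x" and m: "m \<in> carrier (Hom C y' x')"
    and rt: "r \<in> carrier G" "act r y' = y" "t \<in> carrier G" "act t x = act r x'"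
  shows "collapse y x (pair_single y x (y', x') m) = skew_single y x t (actM r y' x' m)"
proof -
  have "collapse y x (pair_single y x (y', x') m) = collapse_at y x (y', x') m"
    unfolding collapse_def
    by (rule module_family.linear_ext_single[OF pair_family[OF obj(1,2)] skew_homs_module[OF obj(1,2)]])
      (use obj m in \<open>auto intro: collapse_at_mod_hom\<close>)
  then show ?thesis
    using collapse_at_eq[OF obj(1) orb_Obj[OF obj(2,3)] rt] by simp
qed

section \<open>The section of \<open>collapse\<close>\<close>

definition expand where "expand y x = linear_ext (carrier G) (\<lambda>s. Hom C y (act s x)) (orbit_homs C (orb y) (orb x))
    (\<lambda>s. pair_single y x (y, act s x))"

lemma expand_summand:
  assumes "x \<in> Obj C" "y \<in> Obj C" "s \<in> carrier G"
  shows "pair_single y x (y, act s x) \<in> mod_hom K (Hom C y (act s x)) (orbit_homs C (orb y) (orb x))"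
  using assms by (intro pair_single_mod_hom) (auto simp: orb_act orbit_refl)

lemma expand_mod_hom:
  assumes "x \<in> Obj C" "y \<in> Obj C"
  shows "expand y x \<in> mod_hom K (skew_homs G C act y x) (orbit_homs C (orb y) (orb x))"
  unfolding expand_def skew_homs_def
  by (intro module_family.linear_ext_mod_hom[OF skew_family] orbit_homs_module expand_summand assms)

lemma expand_single:
  "\<lbrakk>x \<in> Obj C; y \<in> Obj C; s \<in> carrier G; f \<in> carrier (Hom C y (act s x))\<rbrakk> \<Longrightarrow>
    expand y x (skew_single y x s f) = pair_single y x (y, act s x) f"
  unfolding expand_def
  by (rule module_family.linear_ext_single[OF skew_family orbit_homs_module expand_summand])

lemma collapse_expand:
  assumes obj: "x \<in> Obj C" "y \<in> Obj C" and p: "p \<in> carrier (skew_homs G C act y x)"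
  shows "collapse y x (expand y x p) = p"
proof (rule skew_mod_hom_eqI[OF obj skew_homs_module[OF obj]
      mod_hom_compose[OF expand_mod_hom[OF obj] collapse_mod_hom[OF obj]] mod_hom_id _ p])
  fix s f assume s: "s \<in> carrier G" and f: "f \<in> carrier (Hom C y (act s x))"
  \<comment> \<open>The target is already \<open>y\<close>, so the translating element is neutral
    and the index is \<open>s\<close> itself.\<close>
  have "collapse y x (pair_single y x (y, act s x) f) = skew_single y x s (actM \<one>\<^bsub>G\<^esub> y (act s x) f)"
    by (rule collapse_single)
      (use obj s f in \<open>auto simp: act_one act_closed orb_act orbit_refl\<close>)
  then show "collapse y x (expand y x (skew_single y x s f)) = skew_single y x s f"
    using obj s f by (simp add: expand_single actM_one act_closed)
qed

lemma collapse_onto: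
  assumes "x \<in> Obj C" "y \<in> Obj C"
  shows "collapse y x ` carrier (orbit_homs C (orb y) (orb x)) = carrier (skew_homs G C act y x)"
proof
  show "carrier (skew_homs G C act y x) \<subseteq> collapse y x ` carrier (orbit_homs C (orb y) (orb x))"
    using collapse_expand[OF assms] mod_hom_closed[OF expand_mod_hom[OF assms]]
    by (metis image_eqI subsetI)
qed (use assms collapse_closed in auto)

section \<open>The translation action and the kernel of \<open>collapse\<close>\<close>

abbreviation oact where "oact y x \<equiv> orbit_homs_act G act actM (orb y) (orb x)"

lemma orbit_homs_apply:
  "\<lbrakk>u \<in> carrier (orbit_homs C \<beta> \<alpha>); y' \<in> \<beta>; x' \<in> \<alpha>\<rbrakk> \<Longrightarrow> u (y', x') \<in> carrier (Hom C y' x')"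
  using direct_sum_apply[of u "\<beta> \<times> \<alpha>" pair_hom "(y', x')"] by (simp add: orbit_homs_def)

lemma orbit_homs_eqI:
  assumes "u \<in> carrier (orbit_homs C \<beta> \<alpha>)" "v \<in> carrier (orbit_homs C \<beta> \<alpha>)"
    and "\<And>y x. \<lbrakk>y \<in> \<beta>; x \<in> \<alpha>\<rbrakk> \<Longrightarrow> u (y, x) = v (y, x)"
  shows "u = v"
  by (rule direct_sum_eqI[of _ "\<beta> \<times> \<alpha>" pair_hom]) (use assms in \<open>auto simp: orbit_homs_def\<close>)

lemma oact_apply:
  "\<lbrakk>b \<in> orb y; a \<in> orb x\<rbrakk> \<Longrightarrow> oact y x s u (b, a) =
    actM s (act (inv\<^bsub>G\<^esub> s) b) (act (inv\<^bsub>G\<^esub> s) a) (u (act (inv\<^bsub>G\<^esub> s) b, act (inv\<^bsub>G\<^esub> s) a))"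
  by (simp add: orbit_homs_act_def Let_def)

lemma oact_summand:
  assumes obj: "x \<in> Obj C" "y \<in> Obj C" and s: "s \<in> carrier G" and ba: "b \<in> orb y" "a \<in> orb x"
  shows "actM s (act (inv\<^bsub>G\<^esub> s) b) (act (inv\<^bsub>G\<^esub> s) a) \<in>
    mod_hom K (Hom C (act (inv\<^bsub>G\<^esub> s) b) (act (inv\<^bsub>G\<^esub> s) a)) (Hom C b a)"
proof -
  have ba': "a \<in> Obj C" "b \<in> Obj C"
    using obj ba orb_Obj by auto
  then have "act s (act (inv\<^bsub>G\<^esub> s) a) = a" "act s (act (inv\<^bsub>G\<^esub> s) b) = b"
    using s by (simp_all add: act_mult[symmetric] act_one)
  then show ?thesis
    using actM_linear[OF s, of "act (inv\<^bsub>G\<^esub> s) a" "act (inv\<^bsub>G\<^esub> s) b"] ba' s by (simp add: act_closed)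
qed

text \<open>An entry of the translated family is read off at the pair moved back by
  \<open>s\<close>. Its support therefore lies in the translate by \<open>s\<close> of the finite
  support of \<open>u\<close>.\<close>

lemma oact_closed:
  assumes obj: "x \<in> Obj C" "y \<in> Obj C" and s: "s \<in> carrier G"
    and u: "u \<in> carrier (orbit_homs C (orb y) (orb x))"
  shows "oact y x s u \<in> carrier (orbit_homs C (orb y) (orb x))"
  unfolding orbit_homs_def
proof (rule direct_sum_carrierI)
  let ?S = "supp (orb y \<times> orb x) pair_hom u"
  show "finite ((\<lambda>(b, a). (act s b, act s a)) ` ?S)"
    using u by (simp add: orbit_homs_def finite_supp)
  have oact_in: "oact y x s u (b, a) \<in> carrier (Hom C b a)" if "b \<in> orb y" "a \<in> orb x" for b a
    using mod_hom_closed[OF oact_summand[OF obj s that] orbit_homs_apply[OF u]] that obj s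
    by (simp add: oact_apply orb_act)
  then show "oact y x s u \<in> (\<Pi>\<^sub>E i\<in>orb y \<times> orb x. carrier (pair_hom i))"
    by (auto simp: orbit_homs_act_def)
  fix i assume i: "i \<in> orb y \<times> orb x" and notin: "i \<notin> (\<lambda>(b, a). (act s b, act s a)) ` ?S"
  obtain b a where ba: "i = (b, a)" "b \<in> orb y" "a \<in> orb x"
    using i by auto
  let ?b = "act (inv\<^bsub>G\<^esub> s) b" and ?a = "act (inv\<^bsub>G\<^esub> s) a"
  have obj': "b \<in> Obj C" "a \<in> Obj C" "?b \<in> Obj C" "?a \<in> Obj C"
    using ba obj s orb_Obj act_closed inv_closed by meson+
  have "act s ?b = b" "act s ?a = a"
    using s obj' by (simp_all add: act_mult[symmetric] act_one)
  then have "(?b, ?a) \<notin> ?S"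
    using notin ba(1) by (metis (mono_tags, lifting) case_prod_conv image_eqI)
  then have "u (?b, ?a) = \<zero>\<^bsub>Hom C ?b ?a\<^esub>"
    using ba obj s by (simp add: supp_def orb_act)
  then show "oact y x s u i = \<zero>\<^bsub>pair_hom i\<^esub>"
    using mod_hom_zero[OF Hom_module Hom_module oact_summand] ba obj obj' s
    by (simp add: oact_apply)
qed

lemma oact_mod_hom:
  assumes obj: "x \<in> Obj C" "y \<in> Obj C" and s: "s \<in> carrier G"
  shows "oact y x s \<in> mod_hom K (orbit_homs C (orb y) (orb x)) (orbit_homs C (orb y) (orb x))"
proof (rule mod_homI)
  let ?M = "orbit_homs C (orb y) (orb x)"
  interpret M: module K ?M by (rule orbit_homs_module[OF obj])
  note lin = mod_hom_add[OF oact_summand[OF obj s]] mod_hom_smult[OF oact_summand[OF obj s]]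
  show "oact y x s u \<in> carrier ?M" if "u \<in> carrier ?M" for u
    using oact_closed[OF obj s that] .
  fix u assume u: "u \<in> carrier ?M"
  show "oact y x s (u \<oplus>\<^bsub>?M\<^esub> v) = oact y x s u \<oplus>\<^bsub>?M\<^esub> oact y x s v" if v: "v \<in> carrier ?M" for v
  proof (rule orbit_homs_eqI)
    fix b a assume "b \<in> orb y" "a \<in> orb x"
    then show "oact y x s (u \<oplus>\<^bsub>?M\<^esub> v) (b, a) = (oact y x s u \<oplus>\<^bsub>?M\<^esub> oact y x s v) (b, a)"
      using obj s orbit_homs_apply[OF u] orbit_homs_apply[OF v]
      by (simp add: oact_apply orbit_homs_def direct_sum_simps lin orb_act)
  qed (use u v oact_closed[OF obj s] in auto)
  show "oact y x s (a \<odot>\<^bsub>?M\<^esub> u) = a \<odot>\<^bsub>?M\<^esub> oact y x s u" if a: "a \<in> carrier K" for a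
  proof (rule orbit_homs_eqI)
    fix b c assume "b \<in> orb y" "c \<in> orb x"
    then show "oact y x s (a \<odot>\<^bsub>?M\<^esub> u) (b, c) = (a \<odot>\<^bsub>?M\<^esub> oact y x s u) (b, c)"
      using obj s a orbit_homs_apply[OF u]
      by (simp add: oact_apply orbit_homs_def direct_sum_simps lin orb_act)
  qed (use u a oact_closed[OF obj s] in auto)
qed

lemma oact_single:
  assumes obj: "x \<in> Obj C" "y \<in> Obj C" and s: "s \<in> carrier G"
    and o: "y' \<in> orb y" "x' \<in> orb x" and f: "f \<in> carrier (Hom C y' x')"
  shows "oact y x s (pair_single y x (y', x') f) = pair_single y x (act s y', act s x') (actM s y' x' f)"
proof (rule orbit_homs_eqI)
  have obj': "y' \<in> Obj C" "x' \<in> Obj C"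
    using obj o orb_Obj by auto
  show "pair_single y x (act s y', act s x') (actM s y' x' f) \<in> carrier (orbit_homs C (orb y) (orb x))"
    using obj obj' s o f by (intro pair_single_closed actM_closed) (auto simp: orb_act)
  fix b a assume ba: "b \<in> orb y" "a \<in> orb x"
  have ba': "b \<in> Obj C" "a \<in> Obj C"
    using obj ba orb_Obj by auto
  have iff: "act (inv\<^bsub>G\<^esub> s) b = y' \<longleftrightarrow> b = act s y'" "act (inv\<^bsub>G\<^esub> s) a = x' \<longleftrightarrow> a = act s x'"
    using s obj' ba' by (simp_all add: act_inv_eq_iff)
  show "oact y x s (pair_single y x (y', x') f) (b, a) =
      pair_single y x (act s y', act s x') (actM s y' x' f) (b, a)"
  proof (cases "b = act s y' \<and> a = act s x'")
    case True
    then show ?thesis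
      using iff ba o obj s by (simp add: oact_apply single_def orb_act)
  next
    case False
    then show ?thesis
      using iff ba obj s mod_hom_zero[OF Hom_module Hom_module oact_summand[OF obj s ba]] ba'
      by (auto simp: oact_apply single_def orb_act act_closed)
  qed
qed (use assms in \<open>auto intro: oact_closed pair_single_closed\<close>)

lemma collapse_oact:
  assumes obj: "x \<in> Obj C" "y \<in> Obj C" and s: "s \<in> carrier G"
    and u: "u \<in> carrier (orbit_homs C (orb y) (orb x))"
  shows "collapse y x (oact y x s u) = collapse y x u"
proof (rule pair_mod_hom_eqI[OF obj skew_homs_module[OF obj]
      mod_hom_compose[OF oact_mod_hom[OF obj s] collapse_mod_hom[OF obj]] collapse_mod_hom[OF obj] _ u])
  fix y' x' f assume o: "y' \<in> orb y" "x' \<in> orb x" and f: "f \<in> carrier (Hom C y' x')"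
  have obj': "y' \<in> Obj C" "x' \<in> Obj C"
    using obj o orb_Obj by auto
  obtain r t where rt: "r \<in> carrier G" "act r y' = y" "t \<in> carrier G" "act t x = act r x'"
    using obj o by (rule collapse_obtain)
  \<comment> \<open>The translated target \<open>act s y'\<close> is carried to \<open>y\<close> by
    this element. In total \<open>f\<close> is again translated by \<open>r\<close>, and the index
    \<open>t\<close> stays the same.\<close>
  let ?r = "r \<otimes>\<^bsub>G\<^esub> inv\<^bsub>G\<^esub> s"
  have r: "act ?r (act s z) = act r z" if "z \<in> Obj C" for z
    using that rt s by (simp add: act_mult[symmetric] m_assoc)
  have "collapse y x (pair_single y x (act s y', act s x') (actM s y' x' f)) =
      skew_single y x t (actM ?r (act s y') (act s x') (actM s y' x' f))"
    by (rule collapse_single) (use obj o s f obj' rt r in \<open>auto simp: orb_act actM_closed\<close>)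
  also have "\<dots> = collapse y x (pair_single y x (y', x') f)"
    using obj o s f obj' rt by (simp add: actM_mult[symmetric] m_assoc collapse_single[of x y y' x' f r t])
  finally show "collapse y x (oact y x s (pair_single y x (y', x') f)) =
      collapse y x (pair_single y x (y', x') f)"
    using obj s o f by (simp add: oact_single)
qed

lemma oact_one:
  assumes obj: "x \<in> Obj C" "y \<in> Obj C" and u: "u \<in> carrier (orbit_homs C (orb y) (orb x))"
  shows "oact y x \<one>\<^bsub>G\<^esub> u = u"
proof (rule orbit_homs_eqI[OF oact_closed[OF obj one_closed u] u])
  fix b a assume ba: "b \<in> orb y" "a \<in> orb x"
  then have "b \<in> Obj C" "a \<in> Obj C"
    using obj orb_Obj by auto
  then show "oact y x \<one>\<^bsub>G\<^esub> u (b, a) = u (b, a)"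
    using ba orbit_homs_apply[OF u ba] by (simp add: oact_apply act_one actM_one)
qed

lemma collapse_invariant:
  assumes "x \<in> Obj C" "y \<in> Obj C"
  shows "invariant_map K (orbit_homs C (orb y) (orb x)) (skew_homs G C act y x) G (oact y x) (collapse y x)"
  by (intro invariant_map.intro invariant_map_axioms.intro orbit_homs_module skew_homs_module
      is_group collapse_mod_hom oact_closed oact_one collapse_oact assms)

lemma collapse_epi:
  assumes "x \<in> Obj C" "y \<in> Obj C"
  shows "module_epi K (orbit_homs C (orb y) (orb x)) (skew_homs G C act y x) (collapse y x)"
  by (intro module_epi.intro module_epi_axioms.intro orbit_homs_module skew_homs_module
      collapse_mod_hom collapse_onto assms)

text \<open>A homogeneous \<open>f\<close> ending at \<open>y'\<close> is sent to its translate
  \<open>rf\<close>, where \<open>r\<close> carries \<open>y'\<close> to \<open>y\<close>, so the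
  difference is \<open>f - rf\<close>. Since \<open>r\<close> varies with the summand, a general
  difference is a sum of such terms, and closure of the submodule under addition completes the
  induction.\<close>

lemma diff_expand_collapse:
  assumes obj: "x \<in> Obj C" "y \<in> Obj C" and u: "u \<in> carrier (orbit_homs C (orb y) (orb x))"
  shows "u \<oplus>\<^bsub>orbit_homs C (orb y) (orb x)\<^esub>
      \<ominus>\<^bsub>orbit_homs C (orb y) (orb x)\<^esub> expand y x (collapse y x u)
    \<in> quot_submodule K G C act actM (orb y) (orb x)"
proof -
  let ?M = "orbit_homs C (orb y) (orb x)"
  interpret inv: invariant_map K ?M "skew_homs G C act y x" G "oact y x" "collapse y x"
    by (rule collapse_invariant[OF obj])
  interpret fam: module_family K "orb y \<times> orb x" pair_hom
    by (rule pair_family[OF obj])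
  have lin: "(\<lambda>u. expand y x (collapse y x u)) \<in> mod_hom K ?M ?M"
    by (rule mod_hom_compose[OF collapse_mod_hom[OF obj] expand_mod_hom[OF obj]])
  show ?thesis
    using u unfolding quot_submodule_def orbit_homs_def
  proof (induction u rule: fam.direct_sum_induct)
    case zero
    then show ?case
      using inv.aug_submodule_zero mod_hom_zero[OF inv.M.module_axioms inv.M.module_axioms lin]
        inv.M.M.r_neg[OF inv.M.M.zero_closed]
      by (simp only: orbit_homs_def[symmetric])
  next
    case (single i f)
    then obtain y' x' where o: "i = (y', x')" "y' \<in> orb y" "x' \<in> orb x" and f: "f \<in> carrier (Hom C y' x')"
      by auto
    have obj': "y' \<in> Obj C" "x' \<in> Obj C"
      using obj o orb_Obj by auto
    obtain r t where rt: "r \<in> carrier G" "act r y' = y" "t \<in> carrier G" "act t x = act r x'"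
      using obj o(2,3) by (rule collapse_obtain)
    have rf: "actM r y' x' f \<in> carrier (Hom C y (act t x))"
      using actM_closed[OF rt(1) obj'(2,1) f] rt by simp
    have "expand y x (collapse y x (pair_single y x i f)) = pair_single y x (y, act t x) (actM r y' x' f)"
      using collapse_single[OF obj o(2,3) f rt] obj rt rf o by (simp add: expand_single)
    also have "\<dots> = oact y x r (pair_single y x i f)"
      using oact_single[OF obj rt(1) o(2,3) f] rt o by simp
    finally show ?case
      using inv.aug_submodule_diff[OF rt(1) pair_single_closed[OF obj o(2,3) f]] o
      by (simp add: orbit_homs_def[symmetric])
  next
    case (add v w)
    let ?e = "\<lambda>u. expand y x (collapse y x u)"
    have vw: "v \<in> carrier ?M" "w \<in> carrier ?M" "?e v \<in> carrier ?M" "?e w \<in> carrier ?M"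
      using add mod_hom_closed[OF lin] by (simp_all add: orbit_homs_def[symmetric])
    have "(v \<oplus>\<^bsub>?M\<^esub> w) \<oplus>\<^bsub>?M\<^esub> \<ominus>\<^bsub>?M\<^esub> ?e (v \<oplus>\<^bsub>?M\<^esub> w) =
        (v \<oplus>\<^bsub>?M\<^esub> \<ominus>\<^bsub>?M\<^esub> ?e v) \<oplus>\<^bsub>?M\<^esub> (w \<oplus>\<^bsub>?M\<^esub> \<ominus>\<^bsub>?M\<^esub> ?e w)"
      using vw by (simp add: mod_hom_add[OF lin] inv.M.minus_add inv.M.M.a_ac)
    then show ?case
      using inv.aug_submodule_add add.IH by (simp add: orbit_homs_def[symmetric])
  qed
qed

text \<open>On the kernel of \<open>collapse\<close> the image under \<open>expand\<close> is zero,
  so the element coincides with the difference from \<open>diff_expand_collapse\<close>. The other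
  inclusion comes from invariance of \<open>collapse\<close> under translation.\<close>

lemma quot_submodule_eq:
  assumes obj: "x \<in> Obj C" "y \<in> Obj C"
  shows "quot_submodule K G C act actM (orb y) (orb x) =
    module_epi.fibre (orbit_homs C (orb y) (orb x)) (collapse y x) \<zero>\<^bsub>skew_homs G C act y x\<^esub>"
proof -
  let ?M = "orbit_homs C (orb y) (orb x)"
  interpret inv: invariant_map K ?M "skew_homs G C act y x" G "oact y x" "collapse y x"
    by (rule collapse_invariant[OF obj])
  interpret epi: module_epi K ?M "skew_homs G C act y x" "collapse y x"
    by (rule collapse_epi[OF obj])
  show ?thesis
    unfolding quot_submodule_def epi.fibre_def
  proof (rule inv.aug_submodule_eq)
    fix u assume u: "u \<in> carrier ?M" "collapse y x u = \<zero>\<^bsub>skew_homs G C act y x\<^esub>"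
    have neg: "\<ominus>\<^bsub>?M\<^esub> \<zero>\<^bsub>?M\<^esub> = \<zero>\<^bsub>?M\<^esub>"
      by (rule inv.M.M.minus_equality) simp_all
    have zero: "expand y x (collapse y x u) = \<zero>\<^bsub>?M\<^esub>"
      using mod_hom_zero[OF skew_homs_module[OF obj] orbit_homs_module[OF obj] expand_mod_hom[OF obj]] u
      by simp
    show "u \<in> aug_submodule K G ?M (oact y x)"
      using diff_expand_collapse[OF obj u(1)]
      by (simp only: zero neg inv.M.M.r_zero[OF u(1)] quot_submodule_def)
  qed
qed

section \<open>Compatibility of \<open>collapse\<close> with composition\<close>

abbreviation pair_comp where "pair_comp z x \<equiv> \<lambda>(z', y'') (y', x') g f.
    let s = transporter G act y' y'' in
      pair_single z x (z', act s x') (Comp C z' y'' (act s x') g (actM s y' x' f))"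

text \<open>The transporter depends only on the objects \<open>y'\<close> and \<open>y''\<close>,
  not on \<open>f\<close> or \<open>g\<close>; with the indices fixed, the rule is built from linear
  maps.\<close>

lemma pair_bilinear:
  assumes obj: "x \<in> Obj C" "y \<in> Obj C" "z \<in> Obj C"
  shows "bilinear_family K (orb z \<times> orb y) pair_hom (orb y \<times> orb x) pair_hom
    (orbit_homs C (orb z) (orb x)) (pair_comp z x)"
proof (intro bilinear_family.intro bilinear_family_axioms.intro pair_family orbit_homs_module obj)
  fix i j assume "i \<in> orb z \<times> orb y" "j \<in> orb y \<times> orb x"
  then obtain z' y'' y' x' where i: "i = (z', y'')" "z' \<in> orb z" "y'' \<in> orb y"
    and j: "j = (y', x')" "y' \<in> orb y" "x' \<in> orb x"
    by auto
  obtain s where s: "s \<in> carrier G" "act s y' = y''"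
    using obj i j by (metis orb_obtain)
  have obj': "z' \<in> Obj C" "y'' \<in> Obj C" "y' \<in> Obj C" "x' \<in> Obj C" "act s x' \<in> Obj C"
    using obj i j s orb_Obj act_closed by metis+
  have single: "pair_single z x (z', act s x') \<in>
      mod_hom K (Hom C z' (act s x')) (orbit_homs C (orb z) (orb x))"
    using obj i j s by (intro pair_single_mod_hom) (auto intro: orb_act)
  have act: "actM s y' x' \<in> mod_hom K (Hom C y' x') (Hom C y'' (act s x'))"
    using actM_linear[OF s(1) obj'(4,3)] s by simp
  have eq: "pair_comp z x i j =
      (\<lambda>g f. pair_single z x (z', act s x') (Comp C z' y'' (act s x') g (actM s y' x' f)))"
    using obj' by (simp add: i j transporter_eq[OF s(1) obj'(3) s(2)])
  show "(\<lambda>g. pair_comp z x i j g f) \<in> mod_hom K (pair_hom i) (orbit_homs C (orb z) (orb x))"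
    if f: "f \<in> carrier (pair_hom j)" for f
    unfolding eq
    using mod_hom_compose[OF Comp_linear_left[OF obj'(5,2,1)] single] mod_hom_closed[OF act] f i j
    by simp
  show "(\<lambda>f. pair_comp z x i j g f) \<in> mod_hom K (pair_hom j) (orbit_homs C (orb z) (orb x))"
    if g: "g \<in> carrier (pair_hom i)" for g
    unfolding eq
    using mod_hom_compose[OF mod_hom_compose[OF act Comp_linear_right[OF obj'(5,2,1)]] single] g i j
    by simp
qed

lemma orbit_comp_eq_bilinear_ext:
  "orbit_comp G C act actM (orb z) (orb y) (orb x) =
    bilinear_ext (orb z \<times> orb y) pair_hom (orb y \<times> orb x) pair_hom
      (orbit_homs C (orb z) (orb x)) (pair_comp z x)"
  by (intro ext) (simp add: orbit_comp_def bilinear_ext_def case_prod_beta')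

abbreviation ocomp where "ocomp z y x \<equiv> orbit_comp G C act actM (orb z) (orb y) (orb x)"

lemma ocomp_linear_left:
  "\<lbrakk>x \<in> Obj C; y \<in> Obj C; z \<in> Obj C; u \<in> carrier (orbit_homs C (orb y) (orb x))\<rbrakk> \<Longrightarrow>
    (\<lambda>v. ocomp z y x v u) \<in> mod_hom K (orbit_homs C (orb z) (orb y)) (orbit_homs C (orb z) (orb x))"
  using bilinear_family.ext_linear_left[OF pair_bilinear]
  unfolding orbit_comp_eq_bilinear_ext orbit_homs_def[of _ "orb z" "orb y"]
    orbit_homs_def[of _ "orb y" "orb x"] by blast

lemma ocomp_linear_right:
  "\<lbrakk>x \<in> Obj C; y \<in> Obj C; z \<in> Obj C; v \<in> carrier (orbit_homs C (orb z) (orb y))\<rbrakk> \<Longrightarrow>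
    ocomp z y x v \<in> mod_hom K (orbit_homs C (orb y) (orb x)) (orbit_homs C (orb z) (orb x))"
  using bilinear_family.ext_linear_right[OF pair_bilinear]
  unfolding orbit_comp_eq_bilinear_ext orbit_homs_def[of _ "orb z" "orb y"]
    orbit_homs_def[of _ "orb y" "orb x"] by blast

lemma ocomp_closed:
  "\<lbrakk>x \<in> Obj C; y \<in> Obj C; z \<in> Obj C; v \<in> carrier (orbit_homs C (orb z) (orb y));
    u \<in> carrier (orbit_homs C (orb y) (orb x))\<rbrakk> \<Longrightarrow>
    ocomp z y x v u \<in> carrier (orbit_homs C (orb z) (orb x))"
  using mod_hom_closed[OF ocomp_linear_left] by blast

lemma ocomp_single:
  assumes obj: "x \<in> Obj C" "y \<in> Obj C" "z \<in> Obj C"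
    and g: "z' \<in> orb z" "y'' \<in> orb y" "g \<in> carrier (Hom C z' y'')"
    and f: "y' \<in> orb y" "x' \<in> orb x" "f \<in> carrier (Hom C y' x')"
    and s: "s \<in> carrier G" "act s y' = y''"
  shows "ocomp z y x (pair_single z y (z', y'') g) (pair_single y x (y', x') f) =
    pair_single z x (z', act s x') (Comp C z' y'' (act s x') g (actM s y' x' f))"
proof -
  have "y' \<in> Obj C"
    using obj f orb_Obj by blast
  then show ?thesis
    unfolding orbit_comp_eq_bilinear_ext
    using g f by (subst bilinear_family.ext_single[OF pair_bilinear[OF obj]])
      (auto simp: transporter_eq[OF s(1) _ s(2)])
qed

text \<open>On homogeneous elements both sides come from \<open>rg \<circ> rsf\<close>: freeness forces the group
  elements that \<open>collapse\<close> picks for the two factors to multiply to the right one.\<close>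

lemma collapse_ocomp:
  assumes obj: "x \<in> Obj C" "y \<in> Obj C" "z \<in> Obj C"
    and v: "v \<in> carrier (orbit_homs C (orb z) (orb y))"
    and u: "u \<in> carrier (orbit_homs C (orb y) (orb x))"
  shows "collapse z x (ocomp z y x v u) =
    skew_comp G C act actM z y x (collapse z y v) (collapse y x u)"
proof -
  let ?S = "skew_comp G C act actM"
  have 1: "collapse z x (ocomp z y x (pair_single z y (z', y'') g) (pair_single y x (y', x') f)) =
      ?S z y x (collapse z y (pair_single z y (z', y'') g)) (collapse y x (pair_single y x (y', x') f))"
    if g: "z' \<in> orb z" "y'' \<in> orb y" "g \<in> carrier (Hom C z' y'')"
      and f: "y' \<in> orb y" "x' \<in> orb x" "f \<in> carrier (Hom C y' x')"
    for z' y'' g y' x' f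
  proof -
    have obj': "z' \<in> Obj C" "y'' \<in> Obj C" "y' \<in> Obj C" "x' \<in> Obj C"
      using obj g f orb_Obj by metis+
    obtain s where s: "s \<in> carrier G" "act s y' = y''"
      using obj g f by (metis orb_obtain)
    obtain r a where ra: "r \<in> carrier G" "act r z' = z" "a \<in> carrier G" "act a y = act r y''"
      using obj(2,3) g(1,2) by (rule collapse_obtain)
    obtain q b where qb: "q \<in> carrier G" "act q y' = y" "b \<in> carrier G" "act b x = act q x'"
      using obj(1,2) f(1,2) by (rule collapse_obtain)
    \<comment> \<open>Both products carry \<open>y'\<close> to \<open>act r y''\<close>, one by way
      of \<open>y\<close>, the other by way of \<open>y''\<close>.\<close>
    have "act (a \<otimes>\<^bsub>G\<^esub> q) y' = act (r \<otimes>\<^bsub>G\<^esub> s) y'"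
      using obj' s ra qb by (simp add: act_mult)
    then have aq: "a \<otimes>\<^bsub>G\<^esub> q = r \<otimes>\<^bsub>G\<^esub> s"
      using act_inj obj' s ra qb by simp
    \<comment> \<open>As \<open>b\<close> carries \<open>x\<close> to \<open>act q x'\<close>, this
      shows that the product of \<open>a\<close> and \<open>b\<close> is the index which
      \<open>collapse\<close> assigns to the composite.\<close>
    have abx: "act a (act q x') = act r (act s x')"
      using arg_cong[OF aq, of "\<lambda>t. act t x'"] obj' s ra qb by (simp add: act_mult)
    have sf: "actM s y' x' f \<in> carrier (Hom C y'' (act s x'))"
      using actM_closed[OF s(1) obj'(4,3) f(3)] s by simp
    have qf: "actM q y' x' f \<in> carrier (Hom C y (act q x'))"
      using actM_closed[OF qb(1) obj'(4,3) f(3)] qb by simp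
    have rg: "actM r z' y'' g \<in> carrier (Hom C z (act a y))"
      using actM_closed[OF ra(1) obj'(2,1) g(3)] ra by simp
    have rsf: "actM r y'' (act s x') (actM s y' x' f) = actM a y (act q x') (actM q y' x' f)"
      using actM_mult[OF s(1) ra(1) obj'(4,3) f(3)] actM_mult[OF qb(1) ra(3) obj'(4,3) f(3)] aq s qb
      by simp
    have "collapse z x (ocomp z y x (pair_single z y (z', y'') g) (pair_single y x (y', x') f)) =
        collapse z x (pair_single z x (z', act s x') (Comp C z' y'' (act s x') g (actM s y' x' f)))"
      using ocomp_single[OF obj g f s] by simp
    also have "\<dots> = skew_single z x (a \<otimes>\<^bsub>G\<^esub> b)
        (actM r z' (act s x') (Comp C z' y'' (act s x') g (actM s y' x' f)))"
      by (rule collapse_single)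
        (use obj obj' g f s ra qb sf abx in \<open>auto simp: orb_act act_closed act_mult Comp_closed\<close>)
    also have "\<dots> = skew_single z x (a \<otimes>\<^bsub>G\<^esub> b)
        (Comp C z (act a y) (act a (act b x)) (actM r z' y'' g) (actM a y (act b x) (actM q y' x' f)))"
      using obj' s ra qb g sf by (simp add: actM_Comp act_closed rsf abx)
    also have "\<dots> = ?S z y x (skew_single z y a (actM r z' y'' g)) (skew_single y x b (actM q y' x' f))"
      using obj ra qb rg qf by (simp add: skew_comp_single)
    finally show ?thesis
      using collapse_single[OF obj(2,3) g ra] collapse_single[OF obj(1,2) f qb] by simp
  qed
  note lin = ocomp_linear_left ocomp_linear_right skew_comp_linear_left skew_comp_linear_right
    collapse_mod_hom
  note closed = pair_single_closed collapse_closed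
  have 2: "collapse z x (ocomp z y x (pair_single z y (z', y'') g) u) =
      ?S z y x (collapse z y (pair_single z y (z', y'') g)) (collapse y x u)"
    if g: "z' \<in> orb z" "y'' \<in> orb y" "g \<in> carrier (Hom C z' y'')" for z' y'' g
    by (rule pair_mod_hom_eqI[OF obj(1,2) skew_homs_module mod_hom_compose[OF lin(2) lin(5)]
          mod_hom_compose[OF lin(5) lin(4)] 1 u])
      (use obj g in \<open>auto intro!: closed\<close>)
  show ?thesis
    by (rule pair_mod_hom_eqI[OF obj(2,3) skew_homs_module mod_hom_compose[OF lin(1) lin(5)]
          mod_hom_compose[OF lin(5) lin(3)] 2 v])
      (use obj u in \<open>auto intro!: closed\<close>)
qed

section \<open>The functor from the skew category to the quotient\<close>

abbreviation skew_to_quotient where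
  "skew_to_quotient y x \<equiv> module_epi.fibre (orbit_homs C (orb y) (orb x)) (collapse y x)"

lemma quotient_category_simps:
  "Obj (quotient_category K G C act actM) = orb ` Obj C"
  "Hom (quotient_category K G C act actM) \<beta> \<alpha> =
    quot_module (orbit_homs C \<beta> \<alpha>) (quot_submodule K G C act actM \<beta> \<alpha>)"
  "Comp (quotient_category K G C act actM) \<gamma> \<beta> \<alpha> Q P = (\<Union>v\<in>Q. \<Union>u\<in>P.
    quot_submodule K G C act actM \<gamma> \<alpha> +>\<^bsub>orbit_homs C \<gamma> \<alpha>\<^esub> orbit_comp G C act actM \<gamma> \<beta> \<alpha> v u)"
  "Id (quotient_category K G C act actM) \<alpha> = (\<Union>x\<in>\<alpha>.
    quot_submodule K G C act actM \<alpha> \<alpha> +>\<^bsub>orbit_homs C \<alpha> \<alpha>\<^esub>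
      single (\<alpha> \<times> \<alpha>) pair_hom (x, x) (Id C x))"
  by (auto simp: quotient_category_def orbits_def coinvariants_def quot_submodule_def)

text \<open>Well-definedness of the operations in the quotient is settled here. Its composites and
  identities are unions over all representatives, and every representative contributes the same
  fibre: by \<open>collapse_ocomp\<close> for composites, and because the action preserves
  identities for \<open>Id\<close>.\<close>

lemma transported_quotient:
  "transported_category K (skew_category G C act actM) (quotient_category K G C act actM)
    orb skew_to_quotient"
proof (intro transported_category.intro transported_category_axioms.intro skew_category_over,
    unfold skew_category_simps quotient_category_simps)
  fix x y assume obj: "x \<in> Obj C" "y \<in> Obj C"
  interpret epi: module_epi K "orbit_homs C (orb y) (orb x)" "skew_homs G C act y x" "collapse y x"
    by (rule collapse_epi[OF obj])
  note eq = quot_submodule_eq[OF obj]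
  show "bij_betw epi.fibre (carrier (skew_homs G C act y x))
      (carrier (quot_module (orbit_homs C (orb y) (orb x)) (quot_submodule K G C act actM (orb y) (orb x))))"
    unfolding eq by (rule epi.bij_betw_fibre)
  show "epi.fibre \<in> mod_hom K (skew_homs G C act y x)
      (quot_module (orbit_homs C (orb y) (orb x)) (quot_submodule K G C act actM (orb y) (orb x)))"
    unfolding eq by (rule epi.fibre_mod_hom)
  show "epi.fibre \<zero>\<^bsub>skew_homs G C act y x\<^esub> =
      \<zero>\<^bsub>quot_module (orbit_homs C (orb y) (orb x)) (quot_submodule K G C act actM (orb y) (orb x))\<^esub>"
    unfolding eq by (simp add: quot_module_def)
next
  fix x y z p q
  assume obj: "x \<in> Obj C" "y \<in> Obj C" "z \<in> Obj C"
    and p: "p \<in> carrier (skew_homs G C act y x)" and q: "q \<in> carrier (skew_homs G C act z y)"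
  interpret yx: module_epi K "orbit_homs C (orb y) (orb x)" "skew_homs G C act y x" "collapse y x"
    by (rule collapse_epi[OF obj(1,2)])
  interpret zy: module_epi K "orbit_homs C (orb z) (orb y)" "skew_homs G C act z y" "collapse z y"
    by (rule collapse_epi[OF obj(2,3)])
  interpret zx: module_epi K "orbit_homs C (orb z) (orb x)" "skew_homs G C act z x" "collapse z x"
    by (rule collapse_epi[OF obj(1,3)])
  have "quot_submodule K G C act actM (orb z) (orb x) +>\<^bsub>orbit_homs C (orb z) (orb x)\<^esub>
      ocomp z y x v u = zx.fibre (skew_comp G C act actM z y x q p)"
    if "v \<in> zy.fibre q" "u \<in> yx.fibre p" for v u
  proof -
    have "v \<in> carrier (orbit_homs C (orb z) (orb y))" "collapse z y v = q"
      "u \<in> carrier (orbit_homs C (orb y) (orb x))" "collapse y x u = p"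
      using that by (simp_all add: yx.fibre_def zy.fibre_def)
    then show ?thesis
      using obj by (simp add: quot_submodule_eq zx.coset_ker ocomp_closed collapse_ocomp)
  qed
  \<comment> \<open>Both fibres are nonempty, so the union of equal sets is that set and not the
    empty one.\<close>
  moreover obtain v u where "v \<in> zy.fibre q" "u \<in> yx.fibre p"
    using zy.fibre_obtain[OF q] yx.fibre_obtain[OF p] by metis
  ultimately show "zx.fibre (skew_comp G C act actM z y x q p) = (\<Union>v\<in>zy.fibre q. \<Union>u\<in>yx.fibre p.
      quot_submodule K G C act actM (orb z) (orb x) +>\<^bsub>orbit_homs C (orb z) (orb x)\<^esub> ocomp z y x v u)"
    by auto
next
  fix x assume x: "x \<in> Obj C"
  interpret epi: module_epi K "orbit_homs C (orb x) (orb x)" "skew_homs G C act x x" "collapse x x"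
    by (rule collapse_epi[OF x x])
  have "quot_submodule K G C act actM (orb x) (orb x) +>\<^bsub>orbit_homs C (orb x) (orb x)\<^esub>
      pair_single x x (x', x') (Id C x') = epi.fibre (skew_single x x \<one>\<^bsub>G\<^esub> (Id C x))"
    if x': "x' \<in> orb x" for x'
  proof -
    have obj': "x' \<in> Obj C"
      using x x' orb_Obj by blast
    obtain r where r: "r \<in> carrier G" "act r x' = x"
      using x x' orb_obtain orbit_refl by metis
    \<comment> \<open>Source and target are moved from \<open>x'\<close> to \<open>x\<close> by the
      same \<open>r\<close>, so the index is neutral whichever object of the orbit is used.\<close>
    have "collapse x x (pair_single x x (x', x') (Id C x')) =
        skew_single x x \<one>\<^bsub>G\<^esub> (actM r x' x' (Id C x'))"
      by (rule collapse_single) (use x x' obj' r in \<open>auto simp: Id_closed act_one\<close>)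
    then show ?thesis
      using x x' obj' r
      by (simp add: quot_submodule_eq epi.coset_ker pair_single_closed Id_closed actM_Id)
  qed
  then show "epi.fibre (skew_single x x \<one>\<^bsub>G\<^esub> (Id C x)) = (\<Union>x'\<in>orb x.
      quot_submodule K G C act actM (orb x) (orb x) +>\<^bsub>orbit_homs C (orb x) (orb x)\<^esub>
        pair_single x x (x', x') (Id C x'))"
    using orbit_refl[OF x] by auto
qed simp

end

theorem theorem2p8:
  fixes K :: "('k, 'r) ring_scheme"
    and G :: "('g, 'h) monoid_scheme"
    and C :: "('k, 'o, 'm) lincat"
    and act :: "'g \<Rightarrow> 'o \<Rightarrow> 'o"
    and actM :: "'g \<Rightarrow> 'o \<Rightarrow> 'o \<Rightarrow> 'm \<Rightarrow> 'm"
  assumes "cring K"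
    and "group G"
    and "free_G_category K G C act actM"
  shows "equivalent_over K (quotient_category K G C act actM) (skew_category G C act actM)"
  by (rule transported_category.equivalent[OF free_G_category.transported_quotient[OF assms(3)]])

end
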